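(* Let $d_1,\dots,d_l\ge 2$ be natural numbers. The following hold: (1) The $GL_\otimes$-equivariant retraction $conv_\otimes:\mathcal{B}_\otimes(d_1,\dots,d_l)\to\Pi(d_1,\dots,d_l)$, $conv_\otimes(P)=\mathrm{conv}(P\cap\Sigma_{d_1,\dots,d_l})$, is proper. (2) $\Pi(d_1,\dots,d_l)$ is a $GL_\otimes$-strong deformation retract of $\mathcal{B}_\otimes(d_1,\dots,d_l)$.
   Context: For $d\in\mathbb{N}$, $\mathbb{R}^d$ carries its standard inner product. The tensor product $\otimes_{i=1}^l\mathbb{R}^{d_i}$ carries the inner product $\langle\cdot,\cdot\rangle_H$ determined by $\langle x^1\otimes\cdots\otimes x^l,y^1\otimes\cdots\otimes y^l\rangle_H=\prod_{i=1}^l\langle x^i,y^i\rangle$. A 0-symmetric convex body is a compact convex set $P$ with nonempty interior and $P=-P$; $\mathcal{B}(d)$ is the set of these in $\mathbb{R}^d$. The polar is $P^\circ=\{y:\langle x,y\rangle\le 1\ \forall x\in P\}$ (using $\langle\cdot,\cdot\rangle_H$ in the tensor product). For $P_i\in\mathcal{B}(d_i)$, $i=1,\dots,l$, let $P_1\otimes_\pi\cdots\otimes_\pi P_l:=\mathrm{conv}\{x^1\otimes\cdots\otimes x^l: x^i\in P_i\}$ and $P_1\otimes_\epsilon\cdots\otimes_\epsilon P_l:=(P_1^\circ\otimes_\pi\cdots\otimes_\pi P_l^\circ)^\circ$. A 0-symmetric convex body $P\subset\otimes_{i=1}^l\mathbb{R}^{d_i}$ is a tensorial body if there are $P_i\in\mathcal{B}(d_i)$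 with $P_1\otimes_\pi\cdots\otimes_\pi P_l\subseteq P\subseteq P_1\otimes_\epsilon\cdots\otimes_\epsilon P_l$. $\mathcal{B}_\otimes(d_1,\dots,d_l)$ is the set of all tensorial bodies in $\otimes_{i=1}^l\mathbb{R}^{d_i}$, a metric space with the Hausdorff distance induced by the Euclidean norm of $\langle\cdot,\cdot\rangle_H$. $\Pi(d_1,\dots,d_l):=\{P_1\otimes_\pi\cdots\otimes_\pi P_l:P_i\in\mathcal{B}(d_i)\}\subseteq\mathcal{B}_\otimes(d_1,\dots,d_l)$. $\Sigma_{d_1,\dots,d_l}=\{x^1\otimes\cdots\otimes x^l:x^i\in\mathbb{R}^{d_i}\}$ is the set of decomposable vectors. $GL_\otimes=GL_\otimes(d_1,\dots,d_l)$ is the group of linear isomorphisms of $\otimes_{i=1}^l\mathbb{R}^{d_i}$ sending decomposable vectors to decomposable vectors; it acts on $\mathcal{B}_\otimes(d_1,\dots,d_l)$ by $(T,P)\mapsto T(P)$. It is known (from earlier work) that $conv_\otimes$ is a $GL_\otimes$-equivariant retraction of $\mathcal{B}_\otimes(d_1,\dots,d_l)$ onto $\Pi(d_1,\dots,d_l)$. A continuous map is proper if preimages of compact sets are compact. For a topological group $G$ acting on $X$, a subset $A\subseteq X$ is a $G$-strong deformation retract of $X$ if there is a $G$-equivariant continuous map $r:X\to A$ and a homotopy $W:X\times[0,1]\to X$ with $W(\cdot,0)=\mathrm{id}_X$, $W(\cdot,1)=r$, $W(a,t)=a$ for all $a\in A$, $t\in[0,1]$, and each $W(\cdot,t)$ is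 $G$-equivariant. *)

theory Defs
  imports "HOL-Analysis.Analysis"
begin

text \<open>
  Encoding of the spaces. The factors are indexed by an arbitrary finite type \<open>'l\<close>, so
  \<open>l = CARD('l)\<close>. Since the dimensions \<open>d\<^sub>i\<close> may differ, the factor \<open>\<real>\<^bsup>d\<^sub>i\<^esup>\<close> is the coordinate
  subspace of \<open>real ^ 'n\<close> of the vectors supported on an index set \<open>D i :: 'n set\<close>, with
  \<open>d\<^sub>i = card (D i)\<close>. As \<open>'n\<close> is an arbitrary finite type, all tuples of dimensions occur.
  The tensor product is the space of arrays with one index in each \<open>D i\<close>, that is, the coordinate
  subspace of \<open>real ^ ('l \<Rightarrow> 'n)\<close> on the multi-indices \<open>\<alpha>\<close> with \<open>\<alpha> i \<in> D i\<close> for all \<open>i\<close>, and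
  \<open>\<langle>\<cdot>,\<cdot>\<rangle>\<^sub>H\<close> is the standard inner product there (see \<open>inner_tensor\<close> and \<open>span_decomposable\<close>).
\<close>

definition coord_space :: "'k set \<Rightarrow> (real ^ 'k::finite) set" where
  "coord_space J = {x. \<forall>k. k \<notin> J \<longrightarrow> x $ k = 0}"

definition tensor :: "('l::finite \<Rightarrow> real ^ 'n::finite) \<Rightarrow> real ^ ('l \<Rightarrow> 'n)" where
  "tensor x = (\<chi> \<alpha>. \<Prod>i\<in>UNIV. x i $ \<alpha> i)"

definition tensor_space :: "('l::finite \<Rightarrow> 'n::finite set) \<Rightarrow> (real ^ ('l \<Rightarrow> 'n)) set" where
  "tensor_space D = coord_space {\<alpha>. \<forall>i. \<alpha> i \<in> D i}"

definition decomposable :: "('l::finite \<Rightarrow> 'n::finite set) \<Rightarrow> (real ^ ('l \<Rightarrow> 'n)) set" where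
  "decomposable D = tensor ` {x. \<forall>i. x i \<in> coord_space (D i)}"

lemma inner_tensor: "tensor x \<bullet> tensor y = (\<Prod>i\<in>UNIV. x i \<bullet> y i)"
proof -
  have "(\<Prod>i\<in>UNIV. x i \<bullet> y i) = (\<Prod>i\<in>UNIV. \<Sum>k\<in>UNIV. x i $ k * y i $ k)"
    by (simp add: inner_vec_def)
  also have "\<dots> = (\<Sum>\<alpha>\<in>PiE UNIV (\<lambda>_. UNIV). \<Prod>i\<in>UNIV. x i $ \<alpha> i * y i $ \<alpha> i)"
    by (rule prod_sum_PiE) auto
  also have "\<dots> = tensor x \<bullet> tensor y"
    by (simp add: inner_vec_def tensor_def prod.distrib)
  finally show ?thesis ..
qed

lemma subspace_coord_space: "subspace (coord_space J)"
  by (auto simp: coord_space_def subspace_def)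

lemma span_decomposable: "span (decomposable D) = tensor_space D"
proof
  have "decomposable D \<subseteq> tensor_space D"
    by (fastforce simp: decomposable_def tensor_space_def coord_space_def tensor_def)
  then show "span (decomposable D) \<subseteq> tensor_space D"
    unfolding tensor_space_def by (rule span_minimal) (rule subspace_coord_space)
next
  show "tensor_space D \<subseteq> span (decomposable D)"
  proof
    fix z assume z: "z \<in> tensor_space D"
    have "z $ \<alpha> *\<^sub>R axis \<alpha> 1 \<in> span (decomposable D)" for \<alpha>
    proof (cases "\<forall>i. \<alpha> i \<in> D i")
      case True
      have "axis \<alpha> 1 = tensor (\<lambda>i. axis (\<alpha> i) 1)"
        by (auto simp: vec_eq_iff tensor_def axis_def fun_eq_iff)
      moreover have "\<forall>i. axis (\<alpha> i) 1 \<in> coord_space (D i)"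
        using True by (auto simp: coord_space_def axis_def)
      ultimately have "axis \<alpha> 1 \<in> decomposable D"
        unfolding decomposable_def by blast
      then show ?thesis
        by (intro span_scale span_base)
    next
      case False
      then have "z $ \<alpha> = 0"
        using z by (auto simp: tensor_space_def coord_space_def)
      then show ?thesis
        by (simp add: span_zero)
    qed
    then have "(\<Sum>\<alpha>\<in>UNIV. z $ \<alpha> *\<^sub>R axis \<alpha> 1) \<in> span (decomposable D)"
      by (intro span_sum)
    moreover have "(\<Sum>\<alpha>\<in>UNIV. z $ \<alpha> *\<^sub>R axis \<alpha> 1) = z"
      using basis_expansion[of z] by (simp add: scalar_mult_eq_scaleR)
    ultimately show "z \<in> span (decomposable D)" by simp
  qed
qed

text \<open>Interior and polar are taken inside the subspace \<open>V\<close>.\<close>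

definition symmetric_bodies :: "'a::euclidean_space set \<Rightarrow> 'a set set" where
  "symmetric_bodies V = {P. P \<subseteq> V \<and> compact P \<and> convex P \<and>
     (top_of_set V) interior_of P \<noteq> {} \<and> uminus ` P = P}"

definition polar :: "'a::euclidean_space set \<Rightarrow> 'a set \<Rightarrow> 'a set" where
  "polar V P = {y \<in> V. \<forall>x\<in>P. x \<bullet> y \<le> 1}"

definition proj_tensor :: "('l::finite \<Rightarrow> (real ^ 'n::finite) set) \<Rightarrow> (real ^ ('l \<Rightarrow> 'n)) set" where
  "proj_tensor P = convex hull (tensor ` {x. \<forall>i. x i \<in> P i})"

definition inj_tensor ::
  "('l::finite \<Rightarrow> 'n::finite set) \<Rightarrow> ('l \<Rightarrow> (real ^ 'n) set) \<Rightarrow> (real ^ ('l \<Rightarrow> 'n)) set" where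
  "inj_tensor D P = polar (tensor_space D) (proj_tensor (\<lambda>i. polar (coord_space (D i)) (P i)))"

definition tensorial_bodies ::
  "('l::finite \<Rightarrow> 'n::finite set) \<Rightarrow> (real ^ ('l \<Rightarrow> 'n)) set set" where
  "tensorial_bodies D = {Q \<in> symmetric_bodies (tensor_space D).
     \<exists>P. (\<forall>i. P i \<in> symmetric_bodies (coord_space (D i))) \<and>
         proj_tensor P \<subseteq> Q \<and> Q \<subseteq> inj_tensor D P}"

definition proj_bodies ::
  "('l::finite \<Rightarrow> 'n::finite set) \<Rightarrow> (real ^ ('l \<Rightarrow> 'n)) set set" where
  "proj_bodies D = proj_tensor ` {P. \<forall>i. P i \<in> symmetric_bodies (coord_space (D i))}"

definition conv_tensor ::
  "('l::finite \<Rightarrow> 'n::finite set) \<Rightarrow> (real ^ ('l \<Rightarrow> 'n)) set \<Rightarrow> (real ^ ('l \<Rightarrow> 'n)) set" where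
  "conv_tensor D P = convex hull (P \<inter> decomposable D)"

text \<open>
  An isomorphism of \<open>tensor_space D\<close> is represented by linear maps of the ambient type extending it;
  only the values on \<open>tensor_space D\<close> matter for the action on tensorial bodies.
\<close>

definition GL_tensor ::
  "('l::finite \<Rightarrow> 'n::finite set) \<Rightarrow> (real ^ ('l \<Rightarrow> 'n) \<Rightarrow> real ^ ('l \<Rightarrow> 'n)) set" where
  "GL_tensor D = {T. linear T \<and> bij_betw T (tensor_space D) (tensor_space D) \<and>
     T ` decomposable D \<subseteq> decomposable D}"

text \<open>
  Hausdorff distance. On empty or unbounded arguments, where the suprema are meaningless, the value
  is 0 because the locale \<open>Metric_space\<close> demands nonnegativity of the distance everywhere.
\<close>

definition hausdist :: "'a::metric_space set \<Rightarrow> 'a set \<Rightarrow> real" where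
  "hausdist A B =
     (if A = {} \<or> B = {} \<or> \<not> bounded A \<or> \<not> bounded B then 0
      else max (SUP a\<in>A. infdist a B) (SUP b\<in>B. infdist b A))"

lemma bdd_above_infdist:
  assumes "bounded A" "B \<noteq> {}"
  shows "bdd_above ((\<lambda>a. infdist a B) ` A)"
proof -
  from assms obtain b where b: "b \<in> B" by blast
  from assms obtain e where "\<And>a. a \<in> A \<Longrightarrow> dist b a \<le> e"
    by (metis bounded_any_center)
  then have "infdist a B \<le> e" if "a \<in> A" for a
    using infdist_le[OF b, of a] that by (force simp: dist_commute)
  then show ?thesis by (auto simp: bdd_above_def)
qed

lemma infdist_le_hausdist:
  assumes "bounded A" "bounded B" "B \<noteq> {}" "a \<in> A"
  shows "infdist a B \<le> hausdist A B"
proof -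
  have "infdist a B \<le> (SUP a\<in>A. infdist a B)"
    using assms by (intro cSUP_upper bdd_above_infdist) auto
  then show ?thesis using assms by (auto simp: hausdist_def)
qed

lemma hausdist_commute: "hausdist A B = hausdist B A"
  by (auto simp: hausdist_def max.commute)

lemma hausdist_nonneg: "0 \<le> hausdist A B"
proof (cases "A = {} \<or> B = {} \<or> \<not> bounded A \<or> \<not> bounded B")
  case False
  then obtain a where "a \<in> A" by blast
  with False show ?thesis
    using infdist_le_hausdist[of A B a] infdist_nonneg[of a B] by auto
qed (simp add: hausdist_def)

lemma infdist_hausdist_triangle:
  assumes "bounded B" "bounded C" "B \<noteq> {}" "C \<noteq> {}"
  shows "infdist a C \<le> infdist a B + hausdist B C"
proof -
  have "infdist a C - hausdist B C \<le> dist a b" if "b \<in> B" for b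
    using infdist_triangle[of a C b] infdist_le_hausdist[OF assms(1,2,4) that] by linarith
  then have "infdist a C - hausdist B C \<le> infdist a B"
    unfolding infdist_notempty[OF assms(3)] by (intro cINF_greatest assms)
  then show ?thesis by linarith
qed

lemma Metric_space_hausdist:
  assumes M: "\<And>A. A \<in> M \<Longrightarrow> compact A \<and> A \<noteq> {}"
  shows "Metric_space M hausdist"
proof
  show "0 \<le> hausdist A B" for A B :: "'a set" by (rule hausdist_nonneg)
  show "hausdist A B = hausdist B A" for A B :: "'a set" by (rule hausdist_commute)
next
  have bd: "bounded A" "A \<noteq> {}" "closed A" if "A \<in> M" for A
    using M[OF that] compact_imp_bounded compact_imp_closed by auto
  have sub: "A \<subseteq> B" if "A \<in> M" "B \<in> M" "hausdist A B = 0" for A B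
  proof
    fix a assume "a \<in> A"
    then have "infdist a B = 0"
      using infdist_le_hausdist[of A B a] bd that infdist_nonneg[of a B] by force
    then show "a \<in> B"
      using bd that in_closed_iff_infdist_zero by blast
  qed
  show "hausdist A B = 0 \<longleftrightarrow> A = B" if "A \<in> M" "B \<in> M" for A B
  proof
    assume "hausdist A B = 0"
    then show "A = B"
      using sub that hausdist_commute by (metis subset_antisym)
  qed (use bd that in \<open>auto simp: hausdist_def\<close>)
  show "hausdist A C \<le> hausdist A B + hausdist B C" if "A \<in> M" "B \<in> M" "C \<in> M" for A B C
  proof -
    have *: "(SUP a\<in>A. infdist a C) \<le> hausdist A B + hausdist B C"
      if "A \<in> M" "B \<in> M" "C \<in> M" for A B C
    proof (rule cSUP_least)
      fix a assume "a \<in> A"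
      then show "infdist a C \<le> hausdist A B + hausdist B C"
        using infdist_hausdist_triangle[of B C a] infdist_le_hausdist[of A B a] bd that by force
    qed (use bd that in auto)
    show ?thesis
      using *[of A B C] *[of C B A] bd that
      by (auto simp: hausdist_def[of A C] hausdist_commute add.commute)
  qed
qed

lemma Metric_space_tensorial_bodies: "Metric_space (tensorial_bodies D) hausdist"
proof (rule Metric_space_hausdist)
  fix A assume "A \<in> tensorial_bodies D"
  then show "compact A \<and> A \<noteq> {}"
    using interior_of_subset by (fastforce simp: tensorial_bodies_def symmetric_bodies_def)
qed

abbreviation tensorial_topology ::
  "('l::finite \<Rightarrow> 'n::finite set) \<Rightarrow> (real ^ ('l \<Rightarrow> 'n)) set topology" where
  "tensorial_topology D \<equiv> Metric_space.mtopology (tensorial_bodies D) hausdist"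

abbreviation proj_topology ::
  "('l::finite \<Rightarrow> 'n::finite set) \<Rightarrow> (real ^ ('l \<Rightarrow> 'n)) set topology" where
  "proj_topology D \<equiv> subtopology (tensorial_topology D) (proj_bodies D)"

text \<open>
  Proper in the sense that preimages of compact sets are compact; the library's \<open>proper_map\<close> is
  instead a closed map with compact fibres.
\<close>

definition proper_continuous :: "'a topology \<Rightarrow> 'b topology \<Rightarrow> ('a \<Rightarrow> 'b) \<Rightarrow> bool" where
  "proper_continuous X Y f \<longleftrightarrow> continuous_map X Y f \<and>
     (\<forall>K. compactin Y K \<longrightarrow> compactin X {x \<in> topspace X. f x \<in> K})"

text \<open>
  A group of transformations \<open>G\<close>, given as a set with an action map \<open>act\<close>. The topology of \<open>G\<close>
  plays no role in the notions below.
\<close>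

definition equivariant_on :: "'g set \<Rightarrow> ('g \<Rightarrow> 'x \<Rightarrow> 'x) \<Rightarrow> 'x set \<Rightarrow> ('x \<Rightarrow> 'x) \<Rightarrow> bool" where
  "equivariant_on G act S f \<longleftrightarrow>
     (\<forall>g\<in>G. \<forall>x\<in>S. act g x \<in> S \<and> f (act g x) = act g (f x))"

definition strong_G_deformation_retract ::
  "'g set \<Rightarrow> ('g \<Rightarrow> 'x \<Rightarrow> 'x) \<Rightarrow> 'x topology \<Rightarrow> 'x set \<Rightarrow> bool" where
  "strong_G_deformation_retract G act X A \<longleftrightarrow> A \<subseteq> topspace X \<and>
     (\<exists>r W. continuous_map X (subtopology X A) r \<and> equivariant_on G act (topspace X) r \<and>
        continuous_map (prod_topology X (top_of_set {0..1::real})) X (\<lambda>(x, t). W x t) \<and>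
        (\<forall>x\<in>topspace X. W x 0 = x \<and> W x 1 = r x) \<and>
        (\<forall>a\<in>A. \<forall>t\<in>{0..1}. W a t = a) \<and>
        (\<forall>t\<in>{0..1}. equivariant_on G act (topspace X) (\<lambda>x. W x t)))"

end

theory Submission
  imports Defs "HOL-Complex_Analysis.Great_Picard"
begin

text \<open>
  Write \<open>\<Sigma>\<close> for the decomposable tensors. If \<open>Q\<close> lies between \<open>proj_tensor P\<close> and \<open>inj_tensor D P\<close>,
  then \<open>Q \<inter> \<Sigma>\<close> consists of the tensors with factors in the \<open>P i\<close>, so the retraction maps \<open>Q\<close> to
  \<open>proj_tensor P\<close>. Since \<open>\<Sigma>\<close> is a cone, inclusions \<open>(1 - e) A \<subseteq> B \<subseteq> (1 + e) A\<close> pass to the convex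
  hulls of the decomposable parts; this is continuity. For properness, let the images of \<open>Q n\<close>
  converge to \<open>R = proj_tensor P\<close>. Polarity, applied to the decomposable part of the polar of \<open>R\<close>,
  yields \<open>Q n \<subseteq> (1 + e) inj_tensor D P\<close> eventually, so that Blaschke selection gives a limit \<open>Q'\<close>
  with \<open>R \<subseteq> Q' \<subseteq> inj_tensor D P\<close>. The homotopy is the Minkowski combination
  \<open>(1 - t) Q + t conv_tensor D Q\<close>, which stays between the same two bodies.

  Equivariance rests on the structure of decomposability preservers: up to a permutation of the
  factors they are tensor products of linear maps. Indeed, a sum of two decomposable tensors is
  decomposable only if they are proportional in all factors but one, so changing one factor of
  \<open>tensor x\<close> moves exactly one factor of the image, and which one does not depend on \<open>x\<close>.
\<close>

section \<open>Decomposable tensors\<close>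

text \<open>The squared norm of a tensor is the product of the squared norms of its factors.\<close>

lemma tensor_eq_0_iff: "tensor x = 0 \<longleftrightarrow> (\<exists>i. x i = 0)"
proof -
  have "tensor x = 0 \<longleftrightarrow> tensor x \<bullet> tensor x = 0"
    by simp
  also have "\<dots> \<longleftrightarrow> (\<exists>i. x i = 0)"
    by (subst inner_tensor) (simp add: prod_zero_iff)
  finally show ?thesis .
qed

lemma prod_fun_upd:
  fixes g :: "'l::finite \<Rightarrow> 'b \<Rightarrow> real"
  shows "(\<Prod>j\<in>UNIV. g j ((x(i := a)) j)) = g i a * (\<Prod>j\<in>UNIV-{i}. g j (x j))"
  by (subst prod.remove[of UNIV i]) (auto intro!: prod.cong)

lemma inner_tensor_upd:
  "tensor x \<bullet> tensor (y(k := v)) = (x k \<bullet> v) * (\<Prod>j\<in>UNIV-{k}. x j \<bullet> y j)"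
  unfolding inner_tensor by (rule prod_fun_upd)

lemma tensor_scaleR: "tensor (\<lambda>i. c i *\<^sub>R x i) = (\<Prod>i\<in>UNIV. c i) *\<^sub>R tensor x"
  by (simp add: tensor_def vec_eq_iff prod.distrib)

lemma linear_tensor_upd: "linear (\<lambda>y. tensor (x(i := y)))"
proof -
  have "tensor (x(i := y)) $ \<alpha> = y $ \<alpha> i * (\<Prod>j\<in>UNIV-{i}. x j $ \<alpha> j)" for y \<alpha>
    unfolding tensor_def vec_lambda_beta by (rule prod_fun_upd)
  then show ?thesis
    by (intro linearI) (simp_all add: vec_eq_iff algebra_simps)
qed

lemmas tensor_upd_add = linear_add[OF linear_tensor_upd]
lemmas tensor_upd_scale = linear_scale[OF linear_tensor_upd]

lemma tensor_upd_eqD: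
  assumes "tensor (x(i := u)) = tensor (x(i := v))" "\<And>j. j \<noteq> i \<Longrightarrow> x j \<noteq> 0"
  shows "u = v"
proof -
  have "tensor (x(i := u - v)) = 0"
    using linear_diff[OF linear_tensor_upd, of x i u v] assms by simp
  then obtain j where "(x(i := u - v)) j = 0"
    by (auto simp: tensor_eq_0_iff)
  then show ?thesis
    using assms(2)[of j] by (cases "j = i") auto
qed

lemma span_singleton_eq_iff:
  fixes u v :: "'a::real_vector"
  assumes "u \<noteq> 0"
  shows "span {u} = span {v} \<longleftrightarrow> (\<exists>c. c \<noteq> 0 \<and> u = c *\<^sub>R v)"
proof
  assume "span {u} = span {v}"
  then have "u \<in> span {v}" using span_base by blast
  then obtain c where "u = c *\<^sub>R v" by (auto simp: span_singleton)
  then show "\<exists>c. c \<noteq> 0 \<and> u = c *\<^sub>R v" using assms by auto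
next
  assume "\<exists>c. c \<noteq> 0 \<and> u = c *\<^sub>R v"
  then obtain c where c: "c \<noteq> 0" "u = c *\<^sub>R v" by blast
  have "t *\<^sub>R v \<in> range (\<lambda>k. k *\<^sub>R u)" for t
    using c by (intro image_eqI[of _ _ "t / c"]) auto
  then show "span {u} = span {v}"
    using c by (auto simp: span_singleton)
qed

text \<open>One Gram-Schmidt step: the part of \<open>a\<close> orthogonal to \<open>b\<close>,
  rescaled. The span is recorded so that \<open>p\<close> belongs to every subspace containing
  \<open>a\<close> and \<open>b\<close>.\<close>

lemma separating_vector:
  fixes a b :: "'a::real_inner"
  assumes "a \<noteq> 0" "span {a} \<noteq> span {b}"
  obtains p where "a \<bullet> p = 1" "b \<bullet> p = 0" "p \<in> span {a, b}"
proof -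
  \<comment> \<open>For \<open>b = 0\<close> the quotient is 0 by convention, so
    \<open>p = a\<close>.\<close>
  define p where "p = a - ((a \<bullet> b) / (b \<bullet> b)) *\<^sub>R b"
  have pb: "b \<bullet> p = 0"
    by (simp add: p_def inner_diff_right inner_commute)
  have "p \<noteq> 0"
  proof
    assume "p = 0"
    then have a: "a = ((a \<bullet> b) / (b \<bullet> b)) *\<^sub>R b" by (simp add: p_def)
    then have "(a \<bullet> b) / (b \<bullet> b) \<noteq> 0" using assms(1) by (metis scaleR_zero_left)
    with a show False
      using span_singleton_eq_iff[OF assms(1), of b] assms(2) by blast
  qed
  moreover have "p \<bullet> p = a \<bullet> p"
    using pb by (subst p_def) (simp add: inner_diff_left)
  ultimately have "a \<bullet> p \<noteq> 0" by (metis inner_eq_zero_iff)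
  moreover have "p \<in> span {a, b}"
    unfolding p_def by (intro span_diff span_scale span_base) auto
  ultimately show thesis
    using pb by (intro that[of "(1 / (a \<bullet> p)) *\<^sub>R p"]) (auto intro: span_scale)
qed

text \<open>If the \<open>k\<close>-th lines differed, contracting slot \<open>k\<close> with a
  vector orthogonal to \<open>a k\<close> but not to \<open>b k\<close>, and every other slot
  \<open>j\<close> with \<open>b j\<close>, would kill \<open>tensor a\<close> but not
  \<open>tensor b\<close>.\<close>

lemma tensor_eq_imp_span_eq:
  assumes "tensor a = tensor b" "tensor b \<noteq> 0"
  shows "span {a k} = span {b k}"
proof (rule ccontr)
  assume ne: "span {a k} \<noteq> span {b k}"
  have nz: "b j \<noteq> 0" "a j \<noteq> 0" for j
    using assms by (metis tensor_eq_0_iff)+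
  obtain p where p: "b k \<bullet> p = 1" "a k \<bullet> p = 0"
    using separating_vector[of "b k" "a k"] nz ne by metis
  have "tensor b \<bullet> tensor (b(k := p)) = tensor a \<bullet> tensor (b(k := p))"
    using assms by simp
  then show False
    using p nz by (simp add: inner_tensor_upd)
qed

text \<open>Serves to contract a slot of two tensors at once without killing either:
  \<open>a\<close> itself works unless \<open>a\<close> and \<open>b\<close> are orthogonal, and
  then \<open>a + b\<close> does.\<close>

lemma common_nonorthogonal:
  fixes a b :: "'a::real_inner"
  assumes "a \<noteq> 0" "b \<noteq> 0"
  obtains u where "a \<bullet> u \<noteq> 0" "b \<bullet> u \<noteq> 0"
proof (cases "a \<bullet> b = 0")
  case True
  then show thesis
    using assms by (intro that[of "a + b"]) (auto simp: inner_add_right inner_commute)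
next
  case False
  then show thesis using assms by (intro that[of a]) (auto simp: inner_commute)
qed

text \<open>Contracting all other factors leaves a rank-one \<open>2 \<times> 2\<close> matrix which would be diagonal
  with nonzero entries.\<close>

lemma tensor_add_decomposable:
  assumes "tensor a + tensor b = tensor c" "tensor a \<noteq> 0" "tensor b \<noteq> 0" "j \<noteq> k"
  shows "span {a j} = span {b j} \<or> span {a k} = span {b k}"
proof (rule ccontr)
  assume ne: "\<not> ?thesis"
  have nz: "a i \<noteq> 0" "b i \<noteq> 0" for i
    using assms by (metis tensor_eq_0_iff)+
  have "\<exists>p. a i \<bullet> p = 1 \<and> b i \<bullet> p = 0" "\<exists>q. a i \<bullet> q = 0 \<and> b i \<bullet> q = 1"
    if "i \<in> {j, k}" for i
    using separating_vector[of "a i" "b i"] separating_vector[of "b i" "a i"] nz ne that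
    by (metis insertE singletonD)+
  then obtain p q where p: "\<And>i. i \<in> {j, k} \<Longrightarrow> a i \<bullet> p i = 1 \<and> b i \<bullet> p i = 0"
    and q: "\<And>i. i \<in> {j, k} \<Longrightarrow> a i \<bullet> q i = 0 \<and> b i \<bullet> q i = 1"
    by metis
  have "\<exists>u. a i \<bullet> u \<noteq> 0 \<and> b i \<bullet> u \<noteq> 0" for i
    by (rule common_nonorthogonal[OF nz, of i i]) blast
  then obtain u where u: "\<And>i. a i \<bullet> u i \<noteq> 0 \<and> b i \<bullet> u i \<noteq> 0"
    by metis
  define w where "w y z = tensor (u(j := y, k := z))" for y z
  define R where "R x = (\<Prod>i\<in>UNIV-{j,k}. x i \<bullet> u i)" for x
  have w: "tensor x \<bullet> w y z = (x j \<bullet> y) * (x k \<bullet> z) * R x" for x y z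
  proof -
    have "(\<Prod>i\<in>UNIV-{k}. x i \<bullet> (u(j := y)) i)
        = (x j \<bullet> (u(j := y)) j) * (\<Prod>i\<in>UNIV-{k}-{j}. x i \<bullet> (u(j := y)) i)"
      using assms(4) by (intro prod.remove) auto
    also have "(\<Prod>i\<in>UNIV-{k}-{j}. x i \<bullet> (u(j := y)) i) = R x"
      unfolding R_def by (intro prod.cong) auto
    finally show ?thesis
      unfolding w_def inner_tensor_upd by simp
  qed
  have "R a \<noteq> 0" "R b \<noteq> 0"
    using u by (auto simp: R_def)
  have sum: "tensor c \<bullet> w y z = tensor a \<bullet> w y z + tensor b \<bullet> w y z" for y z
    by (simp add: assms(1)[symmetric] inner_add_left)
  have "(tensor c \<bullet> w (p j) (p k)) * (tensor c \<bullet> w (q j) (q k))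
      = (tensor c \<bullet> w (p j) (q k)) * (tensor c \<bullet> w (q j) (p k))"
    by (simp add: w)
  then have "R a * R b = 0"
    using p q unfolding sum by (simp add: w)
  then show False
    using \<open>R a \<noteq> 0\<close> \<open>R b \<noteq> 0\<close> by simp
qed

text \<open>By multilinearity the scalars by which the other factors differ can all be moved into
  slot \<open>k\<close>.\<close>

lemma tensor_eq_upd:
  assumes "\<And>j. j \<noteq> k \<Longrightarrow> span {a j} = span {b j}" "tensor b \<noteq> 0"
  obtains c where "tensor b = tensor (a(k := c *\<^sub>R b k))"
proof -
  have "\<exists>c. b j = c *\<^sub>R a j" if "j \<noteq> k" for j
    using assms span_singleton_eq_iff[of "b j" "a j"] that by (metis tensor_eq_0_iff)
  then obtain c where c: "\<And>j. j \<noteq> k \<Longrightarrow> b j = c j *\<^sub>R a j" by metis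
  \<comment> \<open>Slot \<open>k\<close> takes over \<open>b k\<close> unscaled, hence the value 1
    there.\<close>
  have "b = (\<lambda>j. (c(k := 1)) j *\<^sub>R (a(k := b k)) j)"
    using c by auto
  then have "tensor b = (\<Prod>j\<in>UNIV. (c(k := 1)) j) *\<^sub>R tensor (a(k := b k))"
    by (metis tensor_scaleR)
  also have "\<dots> = tensor (a(k := (\<Prod>j\<in>UNIV. (c(k := 1)) j) *\<^sub>R b k))"
    by (rule tensor_upd_scale[symmetric])
  finally show thesis by (rule that)
qed

text \<open>Meaningful for nonzero decomposable \<open>z\<close> only, whose factors are unique up to scalars.\<close>

definition factor_line :: "'l \<Rightarrow> real ^ ('l::finite \<Rightarrow> 'n::finite) \<Rightarrow> (real ^ 'n) set" where
  "factor_line k z = span {(SOME a. tensor a = z) k}"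

lemma factor_line_tensor: "tensor a \<noteq> 0 \<Longrightarrow> factor_line k (tensor a) = span {a k}"
  unfolding factor_line_def
  by (rule tensor_eq_imp_span_eq) (auto intro: someI[of "\<lambda>b. tensor b = tensor a"])

lemma tensor_in_tensor_space:
  "(\<And>i. x i \<in> coord_space (D i)) \<Longrightarrow> tensor x \<in> tensor_space D"
  using span_base[of "tensor x" "decomposable D"] unfolding span_decomposable
  by (auto simp: decomposable_def)

lemma subspace_tensor_space: "subspace (tensor_space D)"
  unfolding tensor_space_def by (rule subspace_coord_space)

text \<open>Two axis vectors and their sum. Dimension at least 2 enters the argument here: three
  distinct lines permit a pigeonhole between two alternatives, and two of them supply a line
  different from any given one.\<close>

lemma coord_space_nonparallel:
  assumes "card J \<ge> 2"
  obtains u v where "u \<in> coord_space J" "v \<in> coord_space J" "u \<noteq> 0" "v \<noteq> 0" "u + v \<noteq> 0"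
    "span {u} \<noteq> span {v}" "span {u} \<noteq> span {u + v}" "span {v} \<noteq> span {u + v}"
proof -
  obtain p q where pq: "p \<in> J" "q \<in> J" "p \<noteq> q"
    using assms by (metis card_le_Suc0_iff_eq card.infinite not_less_eq_eq numeral_2_eq_2 zero_le)
  define u v :: "real ^ 'a" where "u = axis p 1" and "v = axis q 1"
  have c: "u $ p = 1" "u $ q = 0" "v $ p = 0" "v $ q = 1"
    using pq by (auto simp: u_def v_def axis_def)
  have nz: "u \<noteq> 0" "v \<noteq> 0" "u + v \<noteq> 0"
    using c by (metis zero_index zero_neq_one, metis zero_index zero_neq_one,
        metis add.right_neutral vector_add_component zero_index zero_neq_one)
  have "u \<noteq> t *\<^sub>R v" "u \<noteq> t *\<^sub>R (u + v)" "v \<noteq> t *\<^sub>R (u + v)" for t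
    by (auto dest!: arg_cong[where f = "\<lambda>w. (w $ p, w $ q)"] simp: c)
  moreover have "u \<in> coord_space J" "v \<in> coord_space J"
    using pq by (auto simp: u_def v_def coord_space_def axis_def)
  ultimately show thesis
    using nz by (intro that[of u v]) (simp_all add: span_singleton_eq_iff)
qed

lemma coord_space_nonparallel_to:
  assumes "card J \<ge> 2"
  obtains u where "u \<in> coord_space J" "u \<noteq> 0" "span {a} \<noteq> span {u}"
  using coord_space_nonparallel[OF assms] by metis

section \<open>Linear maps preserving decomposability\<close>

lemma tensor_parallel:
  assumes "tensor f \<noteq> 0" "\<And>k. span {f k} = span {g k}"
  obtains c where "c \<noteq> 0" "tensor f = c *\<^sub>R tensor g"
proof -
  have "\<exists>c. c \<noteq> 0 \<and> f j = c *\<^sub>R g j" for j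
    using span_singleton_eq_iff[of "f j" "g j"] assms tensor_eq_0_iff[of f] by blast
  then obtain c where c: "\<And>j. c j \<noteq> 0 \<and> f j = c j *\<^sub>R g j" by metis
  then have "f = (\<lambda>j. c j *\<^sub>R g j)" by auto
  then have "tensor f = (\<Prod>j\<in>UNIV. c j) *\<^sub>R tensor g"
    using tensor_scaleR by metis
  then show thesis
    using that[of "\<Prod>j\<in>UNIV. c j"] c by simp
qed

section \<open>Lines of the images of decomposable tensors\<close>

locale tensor_preserver =
  fixes D :: "'l::finite \<Rightarrow> 'n::finite set"
    and T :: "real ^ ('l \<Rightarrow> 'n) \<Rightarrow> real ^ ('l \<Rightarrow> 'n)"
  assumes card_D: "\<And>i. card (D i) \<ge> 2"
    and T_GL: "T \<in> GL_tensor D"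
begin

abbreviation E :: "'l \<Rightarrow> (real ^ 'n) set" where
  "E i \<equiv> coord_space (D i)"

text \<open>Tuples without zero factors: by injectivity of \<open>T\<close> their images are
  nonzero, so that \<open>factor_line\<close> is meaningful on them.\<close>

definition X :: "('l \<Rightarrow> real ^ 'n) set" where
  "X = {x. \<forall>i. x i \<in> E i \<and> x i \<noteq> 0}"

definition F :: "('l \<Rightarrow> real ^ 'n) \<Rightarrow> real ^ ('l \<Rightarrow> 'n)" where
  "F x = T (tensor x)"

abbreviation line :: "'l \<Rightarrow> ('l \<Rightarrow> real ^ 'n) \<Rightarrow> (real ^ 'n) set" where
  "line k x \<equiv> factor_line k (F x)"

lemma linear_T: "linear T"
  using T_GL by (simp add: GL_tensor_def)

lemma X_D: "x \<in> X \<Longrightarrow> x i \<in> E i" "x \<in> X \<Longrightarrow> x i \<noteq> 0"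
  by (auto simp: X_def)

lemma X_upd: "x \<in> X \<Longrightarrow> v \<in> E i \<Longrightarrow> v \<noteq> 0 \<Longrightarrow> x(i := v) \<in> X"
  by (auto simp: X_def)

lemma E_lin: "u \<in> E i \<Longrightarrow> v \<in> E i \<Longrightarrow> u + v \<in> E i" "u \<in> E i \<Longrightarrow> c *\<^sub>R u \<in> E i"
  by (simp_all add: subspace_add[OF subspace_coord_space] subspace_scale[OF subspace_coord_space])

lemma F_upd_add: "F (x(i := u + v)) = F (x(i := u)) + F (x(i := v))"
  by (simp add: F_def tensor_upd_add linear_add[OF linear_T])

lemma F_upd_scale: "F (x(i := c *\<^sub>R u)) = c *\<^sub>R F (x(i := u))"
  by (simp add: F_def tensor_upd_scale linear_scale[OF linear_T])

lemma F_eqD: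
  assumes "\<And>j. x j \<in> E j" "\<And>j. y j \<in> E j" "F x = F y"
  shows "tensor x = tensor y"
  using T_GL assms tensor_in_tensor_space[of x D] tensor_in_tensor_space[of y D]
  unfolding F_def GL_tensor_def bij_betw_def inj_on_def by blast

lemma F_decomp:
  assumes "\<And>j. x j \<in> E j"
  obtains f where "\<And>j. f j \<in> E j" "F x = tensor f"
proof -
  have "tensor x \<in> decomposable D"
    using assms by (auto simp: decomposable_def)
  then have "F x \<in> decomposable D"
    using T_GL by (auto simp: GL_tensor_def F_def)
  then show thesis
    using that by (auto simp: decomposable_def)
qed

lemma F_eq_0D: "(\<And>j. x j \<in> E j) \<Longrightarrow> F x = 0 \<Longrightarrow> \<exists>i. x i = 0"
  using F_eqD[of x "\<lambda>_. 0"]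
  by (auto simp: F_def linear_0[OF linear_T] coord_space_def
      iffD2[OF tensor_eq_0_iff, of "\<lambda>_. 0"] tensor_eq_0_iff)

lemma F_X:
  assumes "x \<in> X"
  obtains f where "f \<in> X" "F x = tensor f" "F x \<noteq> 0" "\<And>k. line k x = span {f k}"
proof -
  obtain f where f: "\<And>j. f j \<in> E j" "F x = tensor f"
    using F_decomp[of x] X_D[OF assms] by metis
  have nz: "F x \<noteq> 0"
    using F_eq_0D[of x] X_D[OF assms] by metis
  then have "f \<in> X"
    using f by (auto simp: X_def tensor_eq_0_iff)
  then show thesis
    using that f nz factor_line_tensor by metis
qed

lemma ex_nonparallel:
  obtains u where "u \<in> E i" "u \<noteq> 0" "span {a} \<noteq> span {u}"
  by (rule coord_space_nonparallel_to[OF card_D])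

text \<open>\<open>tensor_add_decomposable\<close> applies to every pair of indices, so the lines
  cannot differ at two of them.\<close>

lemma adjacent:
  assumes "x \<in> X" "y \<in> X" and sum: "F x + F y = F z" "\<And>j. z j \<in> E j"
  shows "\<exists>k. \<forall>j. j \<noteq> k \<longrightarrow> line j x = line j y"
proof -
  obtain f where f: "F x = tensor f" "F x \<noteq> 0" "\<And>k. line k x = span {f k}"
    using F_X[OF assms(1)] by metis
  obtain g where g: "F y = tensor g" "F y \<noteq> 0" "\<And>k. line k y = span {g k}"
    using F_X[OF assms(2)] by metis
  obtain h where h: "F z = tensor h"
    using F_decomp[OF sum(2)] by metis
  have "line j x = line j y \<or> line k x = line k y" if "j \<noteq> k" for j k
    using tensor_add_decomposable[of f g h j k] f g h sum(1) that by simp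
  then show ?thesis by metis
qed

text \<open>The two tensors share all factors but one, so their sum is again a tensor and has a
  decomposable image.\<close>

lemma adjacent_upd:
  assumes "x \<in> X" "v \<in> E i" "v \<noteq> 0"
  shows "\<exists>k. \<forall>j. j \<noteq> k \<longrightarrow> line j x = line j (x(i := v))"
proof (rule adjacent)
  show "F x + F (x(i := v)) = F (x(i := x i + v))"
    using F_upd_add[of x i "x i" v] by simp
  show "(x(i := x i + v)) j \<in> E j" for j
    using X_D[OF assms(1)] assms(2) E_lin by auto
qed (use assms X_upd in auto)

lemma all_lines_eqD:
  assumes "x \<in> X" "y \<in> X" "\<And>k. line k x = line k y"
  obtains c where "F x = c *\<^sub>R F y"
proof -
  obtain f where f: "f \<in> X" "F x = tensor f" "F x \<noteq> 0" "\<And>k. line k x = span {f k}"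
    using F_X[OF assms(1)] by metis
  obtain g where g: "F y = tensor g" "F y \<noteq> 0" "\<And>k. line k y = span {g k}"
    using F_X[OF assms(2)] by metis
  obtain c where "tensor f = c *\<^sub>R tensor g"
    using tensor_parallel[of f g] assms(3) f g by metis
  then show thesis
    using that f g by simp
qed

text \<open>Images with equal lines are proportional; the scalar moves into slot \<open>i\<close>,
  and injectivity of \<open>T\<close> on the tensor space then compares the factors
  themselves.\<close>

lemma all_lines_upd_eqD:
  assumes "x \<in> X" "u \<in> E i" "u \<noteq> 0" "v \<in> E i" "v \<noteq> 0"
    "\<And>k. line k (x(i := u)) = line k (x(i := v))"
  shows "span {u} = span {v}"
proof -
  obtain c where "F (x(i := u)) = c *\<^sub>R F (x(i := v))"
    using all_lines_eqD[of "x(i := u)" "x(i := v)"] assms X_upd by metis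
  then have "F (x(i := u)) = F (x(i := c *\<^sub>R v))"
    by (simp add: F_upd_scale)
  then have "tensor (x(i := u)) = tensor (x(i := c *\<^sub>R v))"
    by (rule F_eqD[rotated 2]) (use assms X_D E_lin in auto)
  then have "u = c *\<^sub>R v"
    using tensor_upd_eqD X_D(2)[OF assms(1)] by blast
  then show ?thesis
    using assms(3) span_singleton_eq_iff[OF assms(3), of v] by auto
qed

section \<open>Which line moves when one factor changes\<close>

definition moves_only :: "('l \<Rightarrow> real ^ 'n) \<Rightarrow> 'l \<Rightarrow> 'l \<Rightarrow> bool" where
  "moves_only x i k \<longleftrightarrow> (\<forall>v\<in>E i. \<forall>j. v \<noteq> 0 \<longrightarrow> j \<noteq> k \<longrightarrow> line j (x(i := v)) = line j x)"

lemma moves_onlyD: "moves_only x i k \<Longrightarrow> v \<in> E i \<Longrightarrow> v \<noteq> 0 \<Longrightarrow> j \<noteq> k \<Longrightarrow> line j (x(i := v)) = line j x"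
  by (auto simp: moves_only_def)

text \<open>All lines other than the \<open>k\<close>-th agree in any case, so agreement of the
  \<open>k\<close>-th makes all agree. Thus line \<open>k\<close> really moves with the direction of
  the factor.\<close>

lemma moves_only_inj:
  assumes "x \<in> X" "moves_only x i k" "u \<in> E i" "u \<noteq> 0" "v \<in> E i" "v \<noteq> 0"
    "line k (x(i := u)) = line k (x(i := v))"
  shows "span {u} = span {v}"
proof (rule all_lines_upd_eqD[OF assms(1,3-6)])
  show "line j (x(i := u)) = line j (x(i := v))" for j
    using assms(7) moves_onlyD[OF assms(2,3,4), of j] moves_onlyD[OF assms(2,5,6), of j]
    by (cases "j = k") auto
qed

text \<open>A vector \<open>w\<close> not parallel to \<open>x i\<close> singles out the index
  \<open>k\<close>. If some \<open>v\<close> moved another line \<open>j\<close>, replacing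
  \<open>v\<close> by \<open>w\<close> would change the lines \<open>j\<close> and \<open>k\<close>
  at once.\<close>

lemma ex_moves_only:
  assumes x: "x \<in> X"
  shows "\<exists>k. moves_only x i k"
proof -
  obtain w where w: "w \<in> E i" "w \<noteq> 0" "span {x i} \<noteq> span {w}"
    by (rule ex_nonparallel)
  obtain k where k: "\<And>j. j \<noteq> k \<Longrightarrow> line j x = line j (x(i := w))"
    using adjacent_upd[OF x w(1,2)] by metis
  \<comment> \<open>Otherwise all lines would agree, making \<open>w\<close> parallel to
    \<open>x i\<close>.\<close>
  have nk: "line k x \<noteq> line k (x(i := w))"
    using all_lines_upd_eqD[OF x X_D[OF x] w(1,2)] w(3) k by (metis fun_upd_triv)
  have "line j (x(i := v)) = line j x" if v: "v \<in> E i" "v \<noteq> 0" and j: "j \<noteq> k" for v j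
  proof (rule ccontr)
    assume ne: "line j (x(i := v)) \<noteq> line j x"
    then have 1: "line k (x(i := v)) = line k x"
      using adjacent_upd[OF x v] j by metis
    have "\<exists>m. \<forall>j. j \<noteq> m \<longrightarrow> line j (x(i := v)) = line j (x(i := w))"
      using adjacent_upd[OF X_upd[OF x v] w(1,2)] by simp
    then have "line k (x(i := v)) = line k (x(i := w))"
      using ne k j by metis
    then show False using 1 nk by simp
  qed
  then show ?thesis
    unfolding moves_only_def by blast
qed

text \<open>For \<open>k \<noteq> k'\<close> the tensors \<open>F (x(i := v))\<close> and \<open>F (x(i := v, j := z))\<close>, whose sum is decomposable,
  would agree in the \<open>k\<close>-th or \<open>k'\<close>-th line; each alternative holds for at most one direction of \<open>v\<close>,
  but there are three directions.\<close>

lemma moves_only_upd_unique: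
  assumes x: "x \<in> X" and z: "z \<in> E j" "z \<noteq> 0" "j \<noteq> i"
    and k: "moves_only x i k" and k': "moves_only (x(j := z)) i k'"
  shows "k = k'"
proof (rule ccontr)
  assume ne: "k \<noteq> k'"
  let ?y = "x(j := z)"
  note y = X_upd[OF x z(1,2)]
  \<comment> \<open>Since \<open>k \<noteq> k'\<close>, \<open>?y(i := v)\<close> keeps the
    \<open>k\<close>-th line of \<open>?y\<close> and \<open>x(i := v)\<close> keeps the
    \<open>k'\<close>-th line of \<open>x\<close>. Agreement in either index therefore ties a moving
    line to a fixed one.\<close>
  have *: "line k (x(i := v)) = line k ?y \<or> line k' (?y(i := v)) = line k' x"
    if v: "v \<in> E i" "v \<noteq> 0" for v
  proof -
    have "\<exists>m. \<forall>n. n \<noteq> m \<longrightarrow> line n (x(i := v)) = line n (?y(i := v))"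
    proof (rule adjacent)
      have "(x(i := v))(j := x j) = x(i := v)" "(x(i := v))(j := z) = ?y(i := v)"
        using z by auto
      then have "F (x(i := v)) + F (?y(i := v)) = F ((x(i := v))(j := x j)) + F ((x(i := v))(j := z))"
        by simp
      then show "F (x(i := v)) + F (?y(i := v)) = F ((x(i := v))(j := x j + z))"
        by (simp add: F_upd_add)
      show "((x(i := v))(j := x j + z)) n \<in> E n" for n
        using X_D[OF x] v z E_lin by auto
    qed (use x y v X_upd in auto)
    then show ?thesis
      using moves_onlyD[OF k v] moves_onlyD[OF k' v] ne by metis
  qed
  obtain u v where uv: "u \<in> E i" "v \<in> E i" "u \<noteq> 0" "v \<noteq> 0" "u + v \<noteq> 0"
    "span {u} \<noteq> span {v}" "span {u} \<noteq> span {u + v}" "span {v} \<noteq> span {u + v}"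
    by (rule coord_space_nonparallel[OF card_D])
  note w = E_lin(1)[OF uv(1,2)]
  have "\<not> (line k (x(i := a)) = line k (x(i := b)) \<or> line k' (?y(i := a)) = line k' (?y(i := b)))"
    if "a \<in> E i" "a \<noteq> 0" "b \<in> E i" "b \<noteq> 0" "span {a} \<noteq> span {b}" for a b
    using moves_only_inj[OF x k that(1-4)] moves_only_inj[OF y k' that(1-4)] that(5) by blast
  \<comment> \<open>Two of the three vectors fall under the same alternative, although no two of
    them are parallel.\<close>
  note this[OF uv(1,3,2,4,6)] this[OF uv(1,3) w uv(5,7)] this[OF uv(2,4) w uv(5,8)]
  then show False
    using *[OF uv(1,3)] *[OF uv(2,4)] *[OF w uv(5)] by argo
qed

lemma moves_only_upd:
  assumes x: "x \<in> X" and z: "z \<in> E j" "z \<noteq> 0" and k: "moves_only x i k"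
  shows "moves_only (x(j := z)) i k"
proof (cases "j = i")
  case True
  then show ?thesis
    using k z by (auto simp: moves_only_def)
next
  case False
  then show ?thesis
    using ex_moves_only[OF X_upd[OF x z], of i] moves_only_upd_unique[OF x z False k] by blast
qed

text \<open>The factors of \<open>e\<close> are exchanged for those of \<open>x\<close> one at a
  time. Every intermediate tuple mixes nonzero factors of the two and so stays in \<open>X\<close>;
  slots outside \<open>A\<close> are never touched.\<close>

lemma X_induct:
  assumes e: "e \<in> X" "Q e" and x: "x \<in> X" and eq: "\<And>i. i \<notin> A \<Longrightarrow> x i = e i"
    and step: "\<And>y j z. y \<in> X \<Longrightarrow> Q y \<Longrightarrow> j \<in> A \<Longrightarrow> z \<in> E j \<Longrightarrow> z \<noteq> 0 \<Longrightarrow> Q (y(j := z))"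
  shows "Q x"
proof -
  have "(\<lambda>i. if i \<in> S then x i else e i) \<in> X \<and> Q (\<lambda>i. if i \<in> S then x i else e i)"
    if "finite S" "S \<subseteq> A" for S
    using that
  proof (induction S rule: finite_induct)
    case empty
    then show ?case using e by simp
  next
    case (insert j S)
    have "(\<lambda>i. if i \<in> insert j S then x i else e i) = (\<lambda>i. if i \<in> S then x i else e i)(j := x j)"
      by auto
    then show ?case
      using insert X_upd X_D[OF x] step by auto
  qed
  moreover have "(\<lambda>i. if i \<in> A then x i else e i) = x"
    using eq by auto
  ultimately show ?thesis
    by (metis finite subset_refl)
qed

section \<open>The permutation of the factors\<close>

definition base :: "'l \<Rightarrow> real ^ 'n" where
  "base = (SOME x. x \<in> X)"

lemma base_X: "base \<in> X"
proof -
  have "\<exists>u. u \<in> E i \<and> u \<noteq> 0" for i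
    by (metis ex_nonparallel)
  then obtain x where "\<And>i. x i \<in> E i \<and> x i \<noteq> 0" by metis
  then have "x \<in> X" by (auto simp: X_def)
  then show ?thesis
    unfolding base_def some_in_eq by blast
qed

text \<open>Chosen at a single tuple; \<open>moves_only_target\<close> carries the choice to all of
  \<open>X\<close>.\<close>

definition target :: "'l \<Rightarrow> 'l" where
  "target i = (SOME k. moves_only base i k)"

lemma moves_only_target:
  assumes "x \<in> X" shows "moves_only x i (target i)"
proof (rule X_induct[OF base_X _ assms, where A = UNIV])
  show "moves_only base i (target i)"
    unfolding target_def using ex_moves_only[OF base_X] by (rule someI_ex)
qed (blast intro: moves_only_upd)+

text \<open>The tuples differ only in slots whose target is not \<open>k\<close>, and changing such
  slots one at a time leaves the \<open>k\<close>-th line alone.\<close>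

lemma line_cong:
  assumes "x \<in> X" "y \<in> X" "\<And>j. target j = k \<Longrightarrow> y j = x j"
  shows "line k y = line k x"
proof (rule X_induct[OF assms(1) _ assms(2), where A = "{j. target j \<noteq> k}"])
  fix z j v assume "z \<in> X" "line k z = line k x" "j \<in> {j. target j \<noteq> k}" "v \<in> E j" "v \<noteq> 0"
  then show "line k (z(j := v)) = line k x"
    using moves_onlyD[OF moves_only_target, of z v j k] by simp
qed (use assms in auto)

text \<open>\<open>T\<close> maps onto the tensor space, which the decomposable tensors span. So
  \<open>w\<close> lies in the span of the images and is orthogonal to itself.\<close>

lemma image_nondegenerate:
  assumes "w \<in> tensor_space D" "\<And>x. (\<And>i. x i \<in> E i) \<Longrightarrow> F x \<bullet> w = 0"
  shows "w = 0"
proof -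
  have "w \<in> T ` tensor_space D"
    using T_GL assms(1) by (simp add: GL_tensor_def bij_betw_def)
  then obtain z where z: "z \<in> tensor_space D" "w = T z" by blast
  have "z \<in> span (decomposable D)"
    using z by (simp add: span_decomposable)
  then have "T z \<bullet> w = 0"
  proof (induction rule: span_induct)
    case base
    show ?case
      by (intro subspaceI) (auto simp: linear_0 linear_add linear_scale linear_T inner_add_left)
  next
    case (step x)
    then show ?case
      using assms(2) by (auto simp: decomposable_def F_def)
  qed
  then show ?thesis using z by simp
qed

text \<open>The test tensor \<open>tensor (f(m := q))\<close> is orthogonal to every image, because
  its inner product with \<open>tensor g\<close> contains the factor \<open>g m \<bullet> q\<close>.
  Hence it vanishes, and only slot \<open>m\<close> can be responsible.\<close>

lemma factor_nondegenerate:
  assumes f: "f \<in> X" and q: "q \<in> E m"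
    and orth: "\<And>x. x \<in> X \<Longrightarrow> \<exists>g. F x = tensor g \<and> g m \<bullet> q = 0"
  shows "q = 0"
proof -
  have "tensor (f(m := q)) = 0"
  proof (rule image_nondegenerate)
    show "tensor (f(m := q)) \<in> tensor_space D"
      using X_D[OF f] q by (intro tensor_in_tensor_space) auto
    show "F x \<bullet> tensor (f(m := q)) = 0" if x: "\<And>i. x i \<in> E i" for x
    proof (cases "x \<in> X")
      case True
      then show ?thesis
        using orth[OF True] by (auto simp: inner_tensor_upd)
    next
      case False
      then have "tensor x = 0"
        using x by (auto simp: X_def tensor_eq_0_iff)
      then show ?thesis
        by (simp add: F_def linear_0[OF linear_T])
    qed
  qed
  then show ?thesis
    using X_D[OF f] by (auto simp: tensor_eq_0_iff split: if_splits)
qed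

text \<open>An index \<open>m\<close> outside the range would have the same \<open>m\<close>-th line
  in all images. As \<open>E m\<close> has dimension at least 2, it contains a nonzero vector
  orthogonal to that line, against \<open>factor_nondegenerate\<close>.\<close>

lemma surj_target: "surj target"
proof (rule ccontr)
  assume "\<not> surj target"
  then obtain m where m: "m \<notin> range target" by blast
  obtain f where f: "f \<in> X" "\<And>k. line k base = span {f k}"
    using F_X[OF base_X] by metis
  obtain u where u: "u \<in> E m" "u \<noteq> 0" "span {f m} \<noteq> span {u}"
    by (rule ex_nonparallel)
  obtain q where q: "u \<bullet> q = 1" "f m \<bullet> q = 0" "q \<in> span {u, f m}"
    using separating_vector[OF u(2), of "f m"] u(3) by metis
  have "span {u, f m} \<subseteq> E m"
    using u X_D[OF f(1)] by (intro span_minimal subspace_coord_space) auto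
  then have "q \<in> E m" using q by blast
  then have "q = 0"
  proof (rule factor_nondegenerate[OF f(1)])
    fix x assume x: "x \<in> X"
    obtain g where g: "g \<in> X" "F x = tensor g" "\<And>k. line k x = span {g k}"
      using F_X[OF x] by metis
    have "line m x = line m base"
      using m by (intro line_cong[OF base_X x]) auto
    then obtain c where "g m = c *\<^sub>R f m"
      using f g X_D(2) span_singleton_eq_iff by metis
    then show "\<exists>g. F x = tensor g \<and> g m \<bullet> q = 0"
      using g q by auto
  qed
  then show False using q by simp
qed

lemma bij_target: "bij target"
  using surj_target finite_UNIV_surj_inj[of target] by (simp add: bij_def)

lemma inv_target [simp]: "inv target (target i) = i" "target (inv target k) = k"
  using bij_target by (simp_all add: bij_is_inj surj_target surj_f_inv_f)

text \<open>Changing slot \<open>i\<close> of \<open>base\<close> changes only slot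
  \<open>target i\<close> of the image. The new factor is read off by contracting the other slots
  with the vectors \<open>g j\<close>, dual to the \<open>f j\<close>, and contraction is
  linear.\<close>

lemma base_factor_maps:
  obtains f t where "f \<in> X" "F base = tensor f" "\<And>i. linear (t i)"
    "\<And>i y. y \<in> E i \<Longrightarrow> t i y \<in> E (target i)"
    "\<And>i y. y \<in> E i \<Longrightarrow> F (base(i := y)) = tensor (f(target i := t i y))"
proof -
  obtain f where f: "f \<in> X" "F base = tensor f" "\<And>k. line k base = span {f k}"
    using F_X[OF base_X] by metis
  define g where "g k = (1 / (f k \<bullet> f k)) *\<^sub>R f k" for k
  have g: "f k \<bullet> g k = 1" for k
    using X_D(2)[OF f(1)] by (simp add: g_def)
  \<comment> \<open>The projection keeps the argument of \<open>T\<close> inside the tensor space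
    for every \<open>y\<close>.\<close>
  define pr :: "'l \<Rightarrow> real ^ 'n \<Rightarrow> real ^ 'n" where "pr i y = (\<chi> n. if n \<in> D i then y $ n else 0)" for i y
  have pr: "pr i y = y" if "y \<in> E i" for i y
    using that by (auto simp: pr_def coord_space_def vec_eq_iff)
  have lin_pr: "linear (pr i)" for i
    by (intro linearI) (auto simp: pr_def vec_eq_iff)
  define t where
    "t i y = (\<chi> n. F (base(i := pr i y)) \<bullet> tensor (g(target i := axis n 1)))" for i y
  have lin: "linear (t i)" for i
    by (intro linearI) (simp_all add: t_def vec_eq_iff linear_add[OF lin_pr]
        linear_scale[OF lin_pr] F_upd_add F_upd_scale inner_add_left)
  have "t i y \<in> E (target i) \<and> F (base(i := y)) = tensor (f(target i := t i y))"
    if y: "y \<in> E i" for i y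
  proof -
    have "\<exists>v\<in>E (target i). F (base(i := y)) = tensor (f(target i := v))"
    proof (cases "y = 0")
      case True
      then have "tensor (base(i := y)) = 0" "tensor (f(target i := 0)) = 0"
        by (auto simp: tensor_eq_0_iff)
      then show ?thesis
        by (intro bexI[of _ 0]) (auto simp: F_def linear_0[OF linear_T] coord_space_def)
    next
      case False
      obtain h where h: "h \<in> X" "F (base(i := y)) = tensor h" "tensor h \<noteq> 0"
          "\<And>k. line k (base(i := y)) = span {h k}"
        using F_X[OF X_upd[OF base_X y False]] by metis
      have "span {f j} = span {h j}" if "j \<noteq> target i" for j
        using moves_onlyD[OF moves_only_target[OF base_X] y False that] f h by simp
      then obtain c where "tensor h = tensor (f(target i := c *\<^sub>R h (target i)))"
        using tensor_eq_upd[of "target i" f h] h by metis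
      then show ?thesis
        using h X_D(1)[OF h(1)] E_lin(2) by metis
    qed
    then obtain v where v: "v \<in> E (target i)" "F (base(i := y)) = tensor (f(target i := v))"
      by blast
    have "(\<Prod>j\<in>UNIV-{target i}. (f(target i := v)) j \<bullet> g j) = 1"
      by (intro prod.neutral) (auto simp: g)
    then have "t i y $ n = v $ n" for n
      unfolding t_def pr[OF y] v(2) inner_tensor_upd by (simp add: inner_axis)
    then have "t i y = v" by (simp add: vec_eq_iff)
    then show ?thesis using v by simp
  qed
  then show thesis
    using that[of f t] f lin by blast
qed

text \<open>The \<open>k\<close>-th line of \<open>F x\<close> depends on slot
  \<open>inv target k\<close> alone and can be computed near \<open>base\<close>, so
  \<open>F x\<close> is a multiple of the tensor of the transformed factors. The multiple is 1 at
  \<open>base\<close> and stays 1 while factors are changed one at a time.\<close>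

lemma tensor_form:
  obtains t where "\<And>i. linear (t i)" "\<And>i. inj_on (t i) (E i)" "\<And>i. t i ` E i = E (target i)"
    "\<And>x. (\<And>i. x i \<in> E i) \<Longrightarrow> F x = tensor (\<lambda>k. t (inv target k) (x (inv target k)))"
proof -
  obtain f t where f: "f \<in> X" "F base = tensor f" and lin: "\<And>i. linear (t i)"
    and tE: "\<And>i y. y \<in> E i \<Longrightarrow> t i y \<in> E (target i)"
    and Ft: "\<And>i y. y \<in> E i \<Longrightarrow> F (base(i := y)) = tensor (f(target i := t i y))"
    using base_factor_maps by blast
  have nz: "t i y \<noteq> 0" if y: "y \<in> E i" "y \<noteq> 0" for i y
  proof
    assume "t i y = 0"
    then have "F (base(i := y)) = 0"
      by (auto simp: Ft[OF y(1)] tensor_eq_0_iff)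
    moreover have "(base(i := y)) j \<in> E j" for j
      using X_D(1)[OF base_X] y by simp
    ultimately have "\<exists>j. (base(i := y)) j = 0"
      by (rule F_eq_0D[rotated])
    then show False
      using X_D(2)[OF base_X] y by (auto split: if_splits)
  qed
  define s where "s x = (\<lambda>k. t (inv target k) (x (inv target k)))" for x
  have "inv target k = i \<longleftrightarrow> k = target i" for k i
    by (metis inv_target)
  then have s_upd: "s (x(i := y)) = (s x)(target i := t i y)" for x i y
    by (auto simp: s_def)
  have s_X: "s x \<in> X" if "x \<in> X" for x
    using X_D[OF that] nz tE[of "x (inv target k)" "inv target k" for k] by (auto simp: s_def X_def)
  \<comment> \<open>An equality of vectors and not only of lines: the factor in one slot is unique
    once the other factors are fixed and nonzero.\<close>
  have s_base: "s base = f"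
  proof
    fix k
    let ?i = "inv target k"
    have "tensor (f(k := f k)) = tensor (f(k := t ?i (base ?i)))"
      using Ft[OF X_D(1)[OF base_X], of ?i] f by simp
    then show "s base k = f k"
      using tensor_upd_eqD X_D(2)[OF f(1)] unfolding s_def by metis
  qed
  have ex_c: "\<exists>c. c \<noteq> 0 \<and> F x = c *\<^sub>R tensor (s x)" if x: "x \<in> X" for x
  proof -
    obtain g where g: "F x = tensor g" "F x \<noteq> 0" "\<And>k. line k x = span {g k}"
      using F_X[OF x] by metis
    have "span {g k} = span {s x k}" for k
    proof -
      let ?i = "inv target k"
      have y: "base(?i := x ?i) \<in> X"
        using X_upd[OF base_X] X_D[OF x] by blast
      have "tensor (f(k := t ?i (x ?i))) \<noteq> 0"
        using nz[OF X_D[OF x]] X_D(2)[OF f(1)] by (auto simp: tensor_eq_0_iff split: if_splits)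
      moreover have "line k x = line k (base(?i := x ?i))"
        by (rule line_cong[OF y x]) auto
      ultimately show ?thesis
        using g(3)[of k] Ft[OF X_D(1)[OF x], of ?i]
          factor_line_tensor[of "f(k := t ?i (x ?i))" k]
        by (simp add: s_def)
    qed
    then show ?thesis
      using tensor_parallel[of g "s x"] g by metis
  qed
  have main: "F x = tensor (s x)" if "x \<in> X" for x
  proof (rule X_induct[OF base_X _ that, where A = UNIV])
    show "F base = tensor (s base)"
      by (simp add: s_base f)
    fix y j z assume y: "y \<in> X" "F y = tensor (s y)" and z: "z \<in> E j" "z \<noteq> 0"
    define u where "u = y j"
    have u: "u \<in> E j" "u \<noteq> 0" "y(j := u) = y"
      using X_D[OF y(1)] by (auto simp: u_def)
    define H where "H v = tensor (s (y(j := v)))" for v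
    have lin_H: "linear H"
      using linear_compose[OF lin[of j] linear_tensor_upd[of "s y" "target j"]]
      by (simp add: H_def[abs_def] s_upd comp_def)
    \<comment> \<open>The scalar 1 passes from \<open>u\<close> to \<open>z\<close> by homogeneity
      if they are parallel, and otherwise by comparing the additivity of \<open>F\<close> and
      \<open>H\<close> at \<open>u + z\<close>.\<close>
    have "F (y(j := z)) = H z"
    proof (cases "span {z} = span {u}")
      case True
      then obtain a where a: "z = a *\<^sub>R u"
        using span_singleton_eq_iff[OF z(2)] by blast
      then show ?thesis
        using y u by (simp add: F_upd_scale linear_scale[OF lin_H]) (simp add: H_def)
    next
      case False
      have uz: "u + z \<in> E j" "u + z \<noteq> 0"
        using E_lin(1)[OF u(1) z(1)] False span_singleton_eq_iff[OF z(2), of u]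
        by (auto simp: add_eq_0_iff intro: exI[of _ "-1"])
      obtain c1 where c1: "c1 \<noteq> 0" "F (y(j := z)) = c1 *\<^sub>R H z"
        using ex_c[OF X_upd[OF y(1) z]] by (auto simp: H_def)
      obtain c2 where c2: "c2 \<noteq> 0" "F (y(j := u + z)) = c2 *\<^sub>R H (u + z)"
        using ex_c[OF X_upd[OF y(1) uz]] by (auto simp: H_def)
      have Hz: "H z = (1 / c1) *\<^sub>R F (y(j := z))" and Hu: "H u = F (y(j := u))"
        using c1 y u by (auto simp: H_def)
      \<comment> \<open>Multilinearity turns the relation between the images into
        \<open>F (y(j := ?v)) = 0\<close>. This forces \<open>?v = 0\<close>, and as
        \<open>u\<close> and \<open>z\<close> are not parallel both coefficients vanish, so
        \<open>c1 = c2 = 1\<close>.\<close>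
      let ?v = "(1 - c2) *\<^sub>R u + (1 - c2 / c1) *\<^sub>R z"
      have "F (y(j := u)) + F (y(j := z)) = c2 *\<^sub>R (F (y(j := u)) + (1 / c1) *\<^sub>R F (y(j := z)))"
        using c2 by (simp add: F_upd_add linear_add[OF lin_H] Hz Hu)
      then have "F (y(j := ?v)) = 0"
        unfolding F_upd_add F_upd_scale by (simp add: algebra_simps)
      moreover have "(y(j := ?v)) i \<in> E i" for i
        using X_D[OF y(1)] u(1) z(1) E_lin by simp
      ultimately have "\<exists>i. (y(j := ?v)) i = 0"
        by (rule F_eq_0D[rotated])
      then have v: "?v = 0"
        using X_D(2)[OF y(1)] by (auto split: if_splits)
      have "1 - c2 / c1 = 0"
      proof (rule ccontr)
        assume ne: "1 - c2 / c1 \<noteq> 0"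
        have "(1 - c2 / c1) *\<^sub>R z = - ((1 - c2) *\<^sub>R u)"
          using v by (simp only: eq_neg_iff_add_eq_0 add.commute)
        then have "inverse (1 - c2 / c1) *\<^sub>R ((1 - c2 / c1) *\<^sub>R z)
            = inverse (1 - c2 / c1) *\<^sub>R (- ((1 - c2) *\<^sub>R u))"
          by (rule arg_cong)
        then have "z = (- inverse (1 - c2 / c1) * (1 - c2)) *\<^sub>R u"
          using ne by (simp only: scaleR_scaleR left_inverse scaleR_one) simp
        then show False
          using False z(2) span_singleton_eq_iff[OF z(2), of u] by (metis scaleR_zero_left)
      qed
      moreover from this have "c2 = 1"
        using v u by simp
      ultimately show ?thesis
        using c1 by simp
    qed
    then show "F (y(j := z)) = tensor (s (y(j := z)))"
      by (simp add: H_def)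
  qed simp
  have F_s: "F x = tensor (s x)" if x: "\<And>i. x i \<in> E i" for x
  proof (cases "x \<in> X")
    case False
    then obtain i where i: "x i = 0"
      using x by (auto simp: X_def)
    then have "s x (target i) = 0"
      by (simp add: s_def linear_0[OF lin])
    then show ?thesis
      using i tensor_eq_0_iff[of x] tensor_eq_0_iff[of "s x"]
      by (auto simp: F_def linear_0[OF linear_T])
  qed (rule main)
  have "inj_on (t i) (E i)" for i
  proof (rule inj_onI)
    fix u v assume uv: "u \<in> E i" "v \<in> E i" "t i u = t i v"
    then have "t i (u - v) = 0" "u - v \<in> E i"
      by (simp_all add: linear_diff[OF lin] subspace_diff[OF subspace_coord_space])
    then show "u = v"
      using nz[of "u - v" i] by auto
  qed
  \<comment> \<open>A nonzero vector of \<open>E (target i)\<close> orthogonal to the image of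
    \<open>t i\<close> would be orthogonal to slot \<open>target i\<close> of every
    \<open>F x\<close>.\<close>
  moreover have "t i ` E i = E (target i)" for i
  proof (rule ccontr)
    assume ne: "t i ` E i \<noteq> E (target i)"
    have "subspace (t i ` E i)"
      by (intro linear_subspace_image lin subspace_coord_space)
    moreover have "t i ` E i \<subset> E (target i)"
      using ne tE by blast
    ultimately have "span (t i ` E i) \<subset> span (E (target i))"
      by (simp add: span_eq_iff[THEN iffD2] subspace_coord_space)
    then obtain q where q: "q \<noteq> 0" "q \<in> span (E (target i))"
      "\<And>y. y \<in> span (t i ` E i) \<Longrightarrow> orthogonal q y"
      using orthogonal_to_subspace_exists_gen by metis
    have "q \<in> E (target i)"
      using q(2) by (simp add: span_eq_iff[THEN iffD2] subspace_coord_space)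
    then have "q = 0"
    proof (rule factor_nondegenerate[OF f(1)])
      fix x assume x: "x \<in> X"
      have "s x (target i) \<bullet> q = 0"
        using q(3)[OF span_base, of "t i (x i)"] X_D(1)[OF x]
        by (simp add: s_def orthogonal_def inner_commute)
      then show "\<exists>g. F x = tensor g \<and> g (target i) \<bullet> q = 0"
        using main[OF x] by blast
    qed
    then show False using q by simp
  qed
  ultimately show thesis
    using that[of t] lin F_s unfolding s_def by blast
qed

end

theorem GL_tensor_structure:
  fixes D :: "'l::finite \<Rightarrow> 'n::finite set"
  assumes "\<And>i. card (D i) \<ge> 2" "T \<in> GL_tensor D"
  obtains s t where "bij s" "\<And>i. linear (t i)" "\<And>i. inj_on (t i) (coord_space (D i))"
    "\<And>i. t i ` coord_space (D i) = coord_space (D (s i))"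
    "\<And>x. (\<And>i. x i \<in> coord_space (D i)) \<Longrightarrow>
      T (tensor x) = tensor (\<lambda>k. t (inv s k) (x (inv s k)))"
proof -
  interpret tensor_preserver D T
    by unfold_locales (use assms in auto)
  obtain t where "\<And>i. linear (t i)" "\<And>i. inj_on (t i) (E i)" "\<And>i. t i ` E i = E (target i)"
    "\<And>x. (\<And>i. x i \<in> E i) \<Longrightarrow> F x = tensor (\<lambda>k. t (inv target k) (x (inv target k)))"
    using tensor_form by blast
  then show thesis
    by (intro that[OF bij_target, of t]) (auto simp: F_def)
qed

section \<open>Symmetric bodies, polars and tensor products\<close>

lemma symmetric_bodiesD:
  assumes "P \<in> symmetric_bodies V"
  shows "P \<subseteq> V" "compact P" "convex P" "bounded P" "closed P" "x \<in> P \<Longrightarrow> - x \<in> P"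
  using assms by (auto simp: symmetric_bodies_def compact_imp_bounded compact_imp_closed)

text \<open>A ball around an interior point \<open>p\<close> has a mirror image around
  \<open>- p\<close>, and the midpoints of \<open>p + v\<close> and \<open>- (p - v)\<close> fill a
  ball around 0.\<close>

lemma symmetric_bodies_ball:
  assumes "P \<in> symmetric_bodies V" "subspace V"
  obtains r where "r > 0" "V \<inter> cball 0 r \<subseteq> P"
proof -
  note P = symmetric_bodiesD[OF assms(1)]
  obtain p where "p \<in> (top_of_set V) interior_of P"
    using assms(1) by (auto simp: symmetric_bodies_def)
  then obtain U where U: "openin (top_of_set V) U" "p \<in> U" "U \<subseteq> P"
    by (auto simp: interior_of_def)
  then obtain r where r: "r > 0" "ball p r \<inter> V \<subseteq> U"
    by (auto simp: openin_contains_ball)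
  have "V \<inter> cball 0 (r / 2) \<subseteq> P"
  proof
    fix v assume v: "v \<in> V \<inter> cball 0 (r / 2)"
    have "p \<in> V" using U P by blast
    then have "p + v \<in> ball p r \<inter> V" "p - v \<in> ball p r \<inter> V"
      using v r assms(2) by (auto simp: subspace_add subspace_diff dist_norm)
    then have "p + v \<in> P" "- (p - v) \<in> P"
      using r U P(6) by blast+
    then have "(1 / 2) *\<^sub>R (p + v) + (1 / 2) *\<^sub>R (- (p - v)) \<in> P"
      by (intro convexD[OF P(3)]) auto
    then show "v \<in> P"
      by (simp add: algebra_simps flip: scaleR_add_left)
  qed
  then show thesis
    using that[of "r / 2"] r by simp
qed

text \<open>A nonempty convex set has a relative interior. Since 0 is the midpoint of
  \<open>p\<close> and \<open>- p\<close>, the affine hull of \<open>P\<close> is its span, that is,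
  \<open>V\<close>.\<close>

lemma symmetric_bodiesI_span:
  assumes "subspace V" "P \<subseteq> V" "compact P" "convex P" "P \<noteq> {}" "\<And>x. x \<in> P \<Longrightarrow> - x \<in> P"
    "V \<subseteq> span P"
  shows "P \<in> symmetric_bodies V"
proof -
  obtain p where p: "p \<in> P" using assms by blast
  then have "(1 / 2) *\<^sub>R p + (1 / 2) *\<^sub>R (- p) \<in> P"
    using assms by (intro convexD[OF assms(4)]) auto
  then have "0 \<in> P" by simp
  then have "affine hull P = span P"
    by (intro affine_hull_span_0 hull_inc)
  also have "\<dots> = V"
    using assms span_minimal by blast
  finally have "rel_interior P = (top_of_set V) interior_of P"
    by (simp add: rel_interior_def interior_of_def)
  then have "(top_of_set V) interior_of P \<noteq> {}"
    using rel_interior_eq_empty[OF assms(4)] assms(5) by simp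
  moreover have "uminus ` P = P"
    using assms(6) by (force intro: image_eqI[of _ _ "- _"])
  ultimately show ?thesis
    using assms by (simp add: symmetric_bodies_def)
qed

lemma span_contains_ball:
  fixes V :: "'a::real_normed_vector set"
  assumes "subspace V" "r > 0" "V \<inter> cball 0 r \<subseteq> P"
  shows "V \<subseteq> span P"
proof
  fix v assume v: "v \<in> V"
  show "v \<in> span P"
  proof (cases "v = 0")
    case False
    then have "(r / norm v) *\<^sub>R v \<in> P"
      using assms v by (auto simp: subspace_scale intro!: subsetD[OF assms(3)])
    then have "(norm v / r) *\<^sub>R ((r / norm v) *\<^sub>R v) \<in> span P"
      by (intro span_scale span_base)
    then show ?thesis using False assms(2) by simp
  qed (simp add: span_zero)
qed

lemma symmetric_bodiesI_ball:
  assumes "subspace V" "P \<subseteq> V" "compact P" "convex P" "\<And>x. x \<in> P \<Longrightarrow> - x \<in> P"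
    "r > 0" "V \<inter> cball 0 r \<subseteq> P"
  shows "P \<in> symmetric_bodies V"
proof (rule symmetric_bodiesI_span)
  show "P \<noteq> {}"
    using assms subspace_0[of V] by force
  show "V \<subseteq> span P"
    using assms by (intro span_contains_ball)
qed (use assms in auto)

lemma symmetric_bodies_0:
  assumes "P \<in> symmetric_bodies V" "subspace V"
  shows "0 \<in> P"
proof -
  obtain r where "r > 0" "V \<inter> cball 0 r \<subseteq> P"
    by (rule symmetric_bodies_ball[OF assms])
  then show ?thesis
    using subspace_0[OF assms(2)] by auto
qed

lemma symmetric_bodies_span:
  assumes "P \<in> symmetric_bodies V" "subspace V"
  shows "span P = V"
proof
  obtain r where "r > 0" "V \<inter> cball 0 r \<subseteq> P"
    by (rule symmetric_bodies_ball[OF assms])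
  then show "V \<subseteq> span P"
    using assms(2) by (intro span_contains_ball)
  show "span P \<subseteq> V"
    using symmetric_bodiesD(1)[OF assms(1)] assms(2) by (rule span_minimal)
qed

lemma symmetric_bodies_shrink:
  assumes "P \<in> symmetric_bodies V" "subspace V" "x \<in> P" "0 \<le> c" "c \<le> 1"
  shows "c *\<^sub>R x \<in> P"
  using convexD[OF symmetric_bodiesD(3)[OF assms(1)] assms(3) symmetric_bodies_0[OF assms(1,2)], of c "1 - c"] assms
  by simp

text \<open>The spanning criterion fits here because linear maps send spans to spans, while balls
  need not go to balls.\<close>

lemma symmetric_bodies_linear_image:
  assumes "P \<in> symmetric_bodies V" "subspace V" "linear f"
  shows "f ` P \<in> symmetric_bodies (f ` V)"
proof (rule symmetric_bodiesI_span)
  note P = symmetric_bodiesD[OF assms(1)]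
  show "subspace (f ` V)" "f ` P \<subseteq> f ` V"
    using assms P by (auto simp: linear_subspace_image)
  show "compact (f ` P)"
    using P assms(3) by (intro compact_continuous_image linear_continuous_on)
      (auto simp: linear_conv_bounded_linear)
  show "convex (f ` P)"
    using P assms(3) by (intro convex_linear_image)
  show "f ` P \<noteq> {}"
    using symmetric_bodies_0[OF assms(1,2)] by auto
  show "- x \<in> f ` P" if "x \<in> f ` P" for x
    using that P(6) linear_neg[OF assms(3)] by (force intro: image_eqI[of _ _ "- _"])
  show "f ` V \<subseteq> span (f ` P)"
    using linear_span_image[OF assms(3), of P] symmetric_bodies_span[OF assms(1,2)] by simp
qed

text \<open>A ball of radius \<open>r\<close> inside \<open>P\<close> bounds the polar by
  \<open>1 / r\<close>, and a bound \<open>M\<close> on \<open>P\<close> puts a ball of radius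
  \<open>1 / M\<close> into the polar.\<close>

lemma polar_symmetric_body:
  assumes "P \<in> symmetric_bodies V" "subspace V"
  shows "polar V P \<in> symmetric_bodies V"
proof -
  note P = symmetric_bodiesD[OF assms(1)]
  obtain r where r: "r > 0" "V \<inter> cball 0 r \<subseteq> P"
    by (rule symmetric_bodies_ball[OF assms])
  obtain M where M: "M > 0" "\<And>x. x \<in> P \<Longrightarrow> norm x \<le> M"
    using P(4) by (auto simp: bounded_pos)
  have eq: "polar V P = V \<inter> (\<Inter>x\<in>P. {y. x \<bullet> y \<le> 1})"
    by (auto simp: polar_def)
  have "norm y \<le> 1 / r" if y: "y \<in> polar V P" for y
  proof (cases "y = 0")
    case False
    have "y \<in> V" using y by (simp add: polar_def)
    then have "(r / norm y) *\<^sub>R y \<in> P"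
      using r False assms(2) by (auto simp: subspace_scale intro!: subsetD[OF r(2)])
    then have "(r / norm y) *\<^sub>R y \<bullet> y \<le> 1"
      using y unfolding polar_def by blast
    then show ?thesis
      using r False by (simp add: dot_square_norm power2_eq_square field_simps)
  qed (use r in simp)
  then have "bounded (polar V P)"
    by (auto simp: bounded_iff)
  moreover have "closed (polar V P)"
    unfolding eq by (intro closed_Int closed_INT closed_subspace assms ballI closed_halfspace_le)
  ultimately have "compact (polar V P)"
    by (simp add: compact_eq_bounded_closed)
  moreover have "convex (polar V P)"
    unfolding eq by (intro convex_Int convex_INT subspace_imp_convex assms convex_halfspace_le)
  moreover have "- y \<in> polar V P" if "y \<in> polar V P" for y
  proof -
    have "- x \<bullet> y \<le> 1" if "x \<in> P" for x
      using \<open>y \<in> polar V P\<close> P(6)[OF that] unfolding polar_def by blast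
    then show ?thesis
      using that assms(2) by (auto simp: polar_def subspace_neg)
  qed
  moreover have "V \<inter> cball 0 (1 / M) \<subseteq> polar V P"
  proof
    fix y assume y: "y \<in> V \<inter> cball 0 (1 / M)"
    have "x \<bullet> y \<le> 1" if "x \<in> P" for x
    proof -
      have "x \<bullet> y \<le> norm x * norm y"
        by (rule norm_cauchy_schwarz)
      also have "\<dots> \<le> M * (1 / M)"
        using M that y by (intro mult_mono) auto
      finally show ?thesis using M by simp
    qed
    then show "y \<in> polar V P"
      using y by (auto simp: polar_def)
  qed
  ultimately show ?thesis
    using assms(2) M(1) by (intro symmetric_bodiesI_ball[of V _ "1 / M"]) (auto simp: polar_def)
qed

text \<open>The orthogonal projection of \<open>adjoint f w\<close> onto \<open>V\<close>. With
  \<open>f = id\<close> it moves a functional into \<open>V\<close>; with a factor map it replaces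
  the adjoint between coordinate spaces.\<close>

lemma adjoint_on_subspace:
  fixes f :: "'a::euclidean_space \<Rightarrow> 'b::euclidean_space"
  assumes "linear f" "subspace V"
  shows "\<exists>y\<in>V. \<forall>x\<in>V. x \<bullet> y = f x \<bullet> w"
proof -
  obtain y z where y: "y \<in> span V" "\<And>v. v \<in> span V \<Longrightarrow> orthogonal z v" "adjoint f w = y + z"
    using orthogonal_subspace_decomp_exists by blast
  have V: "span V = V" using assms(2) by (simp add: span_eq_iff)
  have "x \<bullet> y = f x \<bullet> w" if "x \<in> V" for x
  proof -
    have "f x \<bullet> w = x \<bullet> (y + z)"
      using adjoint_works[OF assms(1)] y(3) by metis
    then show ?thesis
      using y(2)[of x] that V by (simp add: inner_add_right orthogonal_def inner_commute)
  qed
  then show ?thesis using y V by blast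
qed

text \<open>The bipolar theorem inside \<open>V\<close>: the normal of a hyperplane separating
  \<open>z\<close> from \<open>P\<close> is projected to \<open>V\<close> and normalised.\<close>

lemma polar_polar:
  assumes "P \<in> symmetric_bodies V" "subspace V"
  shows "polar V (polar V P) = P"
proof
  note P = symmetric_bodiesD[OF assms(1)]
  show "P \<subseteq> polar V (polar V P)"
    using P(1) by (auto simp: polar_def inner_commute)
  show "polar V (polar V P) \<subseteq> P"
  proof (rule ccontr)
    assume "\<not> polar V (polar V P) \<subseteq> P"
    then obtain z where z: "z \<in> polar V (polar V P)" "z \<notin> P" by blast
    obtain a b where ab: "a \<bullet> z < b" "\<And>x. x \<in> P \<Longrightarrow> a \<bullet> x > b"
      using separating_hyperplane_closed_point[OF P(3,5) z(2)] by blast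
    have b: "b < 0"
      using ab(2)[OF symmetric_bodies_0[OF assms]] by simp
    obtain y where y: "y \<in> V" "\<forall>v\<in>V. v \<bullet> y = id v \<bullet> a"
      using adjoint_on_subspace[OF linear_id assms(2)] by blast
    then have ya: "v \<bullet> y = a \<bullet> v" if "v \<in> V" for v
      using that by (simp add: inner_commute)
    \<comment> \<open>\<open>b\<close> is negative because 0 lies in \<open>P\<close>, so dividing
      by it reverses \<open>b < a \<bullet> x\<close> into the inequality defining the
      polar.\<close>
    have "(1 / b) *\<^sub>R y \<in> polar V P"
      using P(1) y(1) assms(2) b ab(2)
      by (auto simp: polar_def subspace_scale ya subset_iff field_simps less_imp_le)
    then have "(1 / b) *\<^sub>R y \<bullet> z \<le> 1"
      using z(1) unfolding polar_def[of V "polar V P"] by blast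
    moreover have "z \<in> V" using z by (simp add: polar_def)
    ultimately show False
      using ab(1) b ya[of z] by (simp add: inner_commute field_simps)
  qed
qed

section \<open>Projective and injective tensor products\<close>

lemma continuous_on_tensor: "continuous_on S tensor"
  unfolding tensor_def
  by (intro continuous_on_vec_lambda continuous_on_prod continuous_intros
      continuous_on_product_then_coordinatewise continuous_on_id)

lemma compact_tensor_image:
  assumes "\<And>i. compact (P i)"
  shows "compact (tensor ` {x. \<forall>i. x i \<in> P i})"
proof -
  have "compactin (product_topology (\<lambda>_. euclidean) UNIV) (PiE UNIV P)"
    using assms by (simp add: compactin_PiE)
  then have "compact (PiE UNIV P)"
    by (simp add: euclidean_product_topology)
  moreover have "PiE UNIV P = {x. \<forall>i. x i \<in> P i}"
    by (auto simp: PiE_def)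
  ultimately show ?thesis
    by (metis compact_continuous_image continuous_on_tensor)
qed

context
  fixes D :: "'l::finite \<Rightarrow> 'n::finite set" and P :: "'l \<Rightarrow> (real ^ 'n) set"
  assumes P: "\<And>i. P i \<in> symmetric_bodies (coord_space (D i))"
begin

text \<open>For the interior it is enough that the generators span: every tuple of vectors is, up to
  scalars, a tuple from the \<open>P i\<close>, so all decomposable tensors are in the span.\<close>

lemma proj_tensor_symmetric_body: "proj_tensor P \<in> symmetric_bodies (tensor_space D)"
proof (rule symmetric_bodiesI_span)
  let ?G = "tensor ` {x. \<forall>i. x i \<in> P i}"
  note sub = symmetric_bodiesD(1)[OF P]
  have G: "?G \<subseteq> tensor_space D"
    using sub by (auto intro!: tensor_in_tensor_space)
  then show "proj_tensor P \<subseteq> tensor_space D"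
    unfolding proj_tensor_def
    by (intro hull_minimal subspace_imp_convex subspace_tensor_space)
  show "compact (proj_tensor P)"
    unfolding proj_tensor_def
    by (intro compact_convex_hull compact_tensor_image symmetric_bodiesD(2)[OF P])
  have "tensor (\<lambda>_. 0) \<in> ?G"
    using symmetric_bodies_0[OF P subspace_coord_space] by blast
  then show "proj_tensor P \<noteq> {}"
    unfolding proj_tensor_def by auto
  have "uminus ` ?G \<subseteq> ?G"
  proof safe
    fix x assume x: "\<forall>i. x i \<in> P i"
    \<comment> \<open>The index type is nonempty, so some slot can absorb the sign.\<close>
    obtain i :: 'l where True by blast
    have "- tensor x = tensor (x(i := - x i))"
      using linear_neg[OF linear_tensor_upd, of x i "x i"] by simp
    then show "- tensor x \<in> ?G"
      using x symmetric_bodiesD(6)[OF P] by (intro image_eqI[of _ _ "x(i := - x i)"]) auto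
  qed
  then have "convex hull (uminus ` ?G) \<subseteq> proj_tensor P"
    unfolding proj_tensor_def by (rule hull_mono)
  then have "uminus ` proj_tensor P \<subseteq> proj_tensor P"
    unfolding proj_tensor_def by (simp add: convex_hull_linear_image linear_uminus)
  then show "- x \<in> proj_tensor P" if "x \<in> proj_tensor P" for x
    using that by blast
  have "tensor x \<in> span ?G" if x: "\<And>i. x i \<in> coord_space (D i)" for x
  proof -
    have "\<exists>c y. y \<in> P i \<and> x i = c *\<^sub>R y" for i
    proof -
      obtain r where r: "r > 0" "coord_space (D i) \<inter> cball 0 r \<subseteq> P i"
        by (rule symmetric_bodies_ball[OF P subspace_coord_space])
      \<comment> \<open>Adding 1 to the norm covers the case \<open>x i = 0\<close>.\<close>
      have "(r / (norm (x i) + 1)) *\<^sub>R x i \<in> P i"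
        using r x[of i] subspace_coord_space[of "D i"]
        by (intro subsetD[OF r(2)]) (auto simp: subspace_scale field_simps add_pos_nonneg)
      moreover have "x i = ((norm (x i) + 1) / r) *\<^sub>R ((r / (norm (x i) + 1)) *\<^sub>R x i)"
        using r by (simp add: add_nonneg_eq_0_iff)
      ultimately show ?thesis by blast
    qed
    then obtain c y where cy: "\<And>i. y i \<in> P i \<and> x i = c i *\<^sub>R y i" by metis
    then have "x = (\<lambda>i. c i *\<^sub>R y i)" by auto
    then have "tensor x = (\<Prod>i\<in>UNIV. c i) *\<^sub>R tensor y"
      by (metis tensor_scaleR)
    then show ?thesis
      using cy by (simp only:) (intro span_scale span_base imageI, simp)
  qed
  then have "decomposable D \<subseteq> span ?G"
    by (auto simp: decomposable_def)
  then have "span (decomposable D) \<subseteq> span ?G"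
    by (intro span_minimal subspace_span)
  also have "\<dots> \<subseteq> span (proj_tensor P)"
    unfolding proj_tensor_def by (intro span_mono hull_subset)
  finally show "tensor_space D \<subseteq> span (proj_tensor P)"
    by (simp add: span_decomposable)
qed (simp_all add: subspace_tensor_space proj_tensor_def)

lemma polar_factors: "polar (coord_space (D i)) (P i) \<in> symmetric_bodies (coord_space (D i))"
  by (rule polar_symmetric_body[OF P subspace_coord_space])

text \<open>Halfspaces are convex, so a polar of a convex hull can be tested on the
  generators.\<close>

lemma in_inj_tensor_iff:
  "z \<in> inj_tensor D P \<longleftrightarrow> z \<in> tensor_space D \<and>
    (\<forall>y. (\<forall>i. y i \<in> polar (coord_space (D i)) (P i)) \<longrightarrow> tensor y \<bullet> z \<le> 1)"
proof -
  have *: "(\<forall>w \<in> convex hull S. w \<bullet> z \<le> 1) \<longleftrightarrow> (\<forall>w \<in> S. w \<bullet> z \<le> 1)" for S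
  proof
    assume "\<forall>w \<in> S. w \<bullet> z \<le> 1"
    then have "convex hull S \<subseteq> {w. z \<bullet> w \<le> 1}"
      by (intro hull_minimal convex_halfspace_le) (auto simp: inner_commute)
    then show "\<forall>w \<in> convex hull S. w \<bullet> z \<le> 1"
      by (auto simp: inner_commute)
  qed (use hull_subset[of S convex] in blast)
  show ?thesis
    unfolding inj_tensor_def polar_def[of "tensor_space D"] proj_tensor_def mem_Collect_eq *
    by blast
qed

text \<open>Symmetry of each \<open>P i\<close> bounds \<open>y i \<bullet> x i\<close> in absolute
  value, so that the bounds can be multiplied.\<close>

lemma proj_tensor_subset_inj: "proj_tensor P \<subseteq> inj_tensor D P"
proof -
  have "tensor x \<in> inj_tensor D P" if x: "\<forall>i. x i \<in> P i" for x
    unfolding in_inj_tensor_iff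
  proof (intro conjI allI impI)
    show "tensor x \<in> tensor_space D"
      using x symmetric_bodiesD(1)[OF P] by (intro tensor_in_tensor_space) auto
    fix y assume y: "\<forall>i. y i \<in> polar (coord_space (D i)) (P i)"
    have "\<bar>y i \<bullet> x i\<bar> \<le> 1" for i
      using y x symmetric_bodiesD(6)[OF P, of "x i" i]
      by (force simp: polar_def abs_le_iff inner_commute)
    then have "\<bar>\<Prod>i\<in>UNIV. y i \<bullet> x i\<bar> \<le> 1"
      by (auto simp: abs_prod intro: prod_le_1)
    then show "tensor y \<bullet> tensor x \<le> 1"
      by (simp add: inner_tensor)
  qed
  moreover have "convex (inj_tensor D P)"
    unfolding inj_tensor_def polar_def
    by (intro convexI) (auto simp: inner_add_right intro!: convex_bound_le
        subspace_add subspace_scale subspace_tensor_space)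
  ultimately show ?thesis
    unfolding proj_tensor_def by (intro hull_minimal) auto
qed

text \<open>The dual norms of the factors are attained at some \<open>y\<close>, and
  \<open>\<langle>tensor y, tensor x\<rangle>\<close> is the product of the gauges of the factors of \<open>x\<close>.\<close>

lemma inj_tensor_decomposable:
  "inj_tensor D P \<inter> decomposable D = tensor ` {x. \<forall>i. x i \<in> P i}"
proof
  show "tensor ` {x. \<forall>i. x i \<in> P i} \<subseteq> inj_tensor D P \<inter> decomposable D"
  proof (rule Int_greatest)
    show "tensor ` {x. \<forall>i. x i \<in> P i} \<subseteq> inj_tensor D P"
      using hull_subset[of _ convex] proj_tensor_subset_inj unfolding proj_tensor_def
      by (rule order_trans)
    show "tensor ` {x. \<forall>i. x i \<in> P i} \<subseteq> decomposable D"
      using symmetric_bodiesD(1)[OF P] unfolding decomposable_def by blast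
  qed
next
  show "inj_tensor D P \<inter> decomposable D \<subseteq> tensor ` {x. \<forall>i. x i \<in> P i}"
  proof
    fix z assume z: "z \<in> inj_tensor D P \<inter> decomposable D"
    then obtain x where x: "z = tensor x" "\<And>i. x i \<in> coord_space (D i)"
      by (auto simp: decomposable_def)
    let ?Q = "\<lambda>i. polar (coord_space (D i)) (P i)"
    show "z \<in> tensor ` {x. \<forall>i. x i \<in> P i}"
    proof (cases "z = 0")
      case True
      then have "z = tensor (\<lambda>_. 0)"
        by (simp add: tensor_eq_0_iff[THEN iffD2])
      then show ?thesis
        using symmetric_bodies_0[OF P subspace_coord_space] by blast
    next
      case False
      then have nz: "x i \<noteq> 0" for i
        using x by (auto simp: tensor_eq_0_iff)
      have "\<exists>y\<in>?Q i. (\<forall>w\<in>?Q i. x i \<bullet> w \<le> x i \<bullet> y) \<and> 0 < x i \<bullet> y" for i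
      proof -
        note Q = polar_factors[of i]
        obtain y where y: "y \<in> ?Q i" "\<And>w. w \<in> ?Q i \<Longrightarrow> x i \<bullet> w \<le> x i \<bullet> y"
          using continuous_attains_sup[of "?Q i" "\<lambda>w. x i \<bullet> w"] symmetric_bodiesD(2)[OF Q]
            symmetric_bodies_0[OF Q subspace_coord_space]
          by (force intro: continuous_intros)
        obtain r where r: "r > 0" "coord_space (D i) \<inter> cball 0 r \<subseteq> ?Q i"
          by (rule symmetric_bodies_ball[OF Q subspace_coord_space])
        have "(r / norm (x i)) *\<^sub>R x i \<in> ?Q i"
          using r x(2)[of i] nz[of i] subspace_coord_space[of "D i"]
          by (intro subsetD[OF r(2)]) (auto simp: subspace_scale)
        then have "x i \<bullet> (r / norm (x i)) *\<^sub>R x i \<le> x i \<bullet> y"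
          by (rule y(2))
        moreover have "0 < x i \<bullet> (r / norm (x i)) *\<^sub>R x i"
          using nz[of i] r by simp
        ultimately show ?thesis
          using y by (intro bexI[of _ y]) auto
      qed
      then obtain y where y: "\<And>i. y i \<in> ?Q i" "\<And>i w. w \<in> ?Q i \<Longrightarrow> x i \<bullet> w \<le> x i \<bullet> y i"
        "\<And>i. 0 < x i \<bullet> y i" by metis
      define m where "m i = x i \<bullet> y i" for i
      define x' where "x' i = (1 / m i) *\<^sub>R x i" for i
      \<comment> \<open>\<open>m i\<close> is the maximum of \<open>x i\<close> over the polar, so
        \<open>x' i\<close> is at most 1 there and lies in the bipolar.\<close>
      have x': "x' i \<in> P i" for i
      proof -
        have "x' i \<in> polar (coord_space (D i)) (?Q i)"
          using x(2)[of i] y(2)[where i = i] y(3)[of i] subspace_coord_space[of "D i"]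
          unfolding polar_def[of _ "?Q i"] x'_def m_def
          by (auto simp: subspace_scale inner_commute)
        then show ?thesis
          using polar_polar[OF P subspace_coord_space] by metis
      qed
      define c where "c = (\<Prod>i\<in>UNIV. m i)"
      have "tensor y \<bullet> tensor x \<le> 1"
        using z x(1) y(1) by (auto simp: in_inj_tensor_iff)
      then have c: "0 \<le> c" "c \<le> 1"
        using y(3) by (auto simp: c_def inner_tensor m_def inner_commute less_imp_le intro!: prod_nonneg)
      have "x = (\<lambda>i. m i *\<^sub>R x' i)"
        using y(3) by (auto simp: x'_def m_def less_imp_neq[symmetric])
      then have "z = c *\<^sub>R tensor x'"
        unfolding c_def x(1) by (metis tensor_scaleR)
      \<comment> \<open>The whole scalar \<open>c\<close> goes into one slot, which stays in its
        body because \<open>0 \<le> c\<close> and \<open>c \<le> 1\<close>.\<close>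
      obtain i :: 'l where True by blast
      have "z = tensor (x'(i := c *\<^sub>R x' i))"
        using \<open>z = c *\<^sub>R tensor x'\<close> by (simp add: tensor_upd_scale)
      moreover have "c *\<^sub>R x' i \<in> P i"
        using symmetric_bodies_shrink[OF P subspace_coord_space x' c] .
      ultimately show ?thesis
        using x' by (intro image_eqI[of _ _ "x'(i := c *\<^sub>R x' i)"]) auto
    qed
  qed
qed

text \<open>Both bounds have the same decomposable part by \<open>inj_tensor_decomposable\<close>,
  and this pins down that of \<open>Q\<close>.\<close>

lemma between_decomposable:
  assumes "proj_tensor P \<subseteq> Q" "Q \<subseteq> inj_tensor D P"
  shows "Q \<inter> decomposable D = tensor ` {x. \<forall>i. x i \<in> P i}" "conv_tensor D Q = proj_tensor P"
proof -
  have "tensor ` {x. \<forall>i. x i \<in> P i} \<subseteq> proj_tensor P"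
    unfolding proj_tensor_def by (rule hull_subset)
  then show "Q \<inter> decomposable D = tensor ` {x. \<forall>i. x i \<in> P i}"
    using inj_tensor_decomposable assms by blast
  then show "conv_tensor D Q = proj_tensor P"
    by (simp add: conv_tensor_def proj_tensor_def)
qed

text \<open>Makes \<open>inj_tensor_decomposable\<close> applicable to the polar of a projective
  body.\<close>

lemma inj_tensor_polar_eq:
  "inj_tensor D (\<lambda>i. polar (coord_space (D i)) (P i)) = polar (tensor_space D) (proj_tensor P)"
  by (simp add: inj_tensor_def polar_polar[OF P subspace_coord_space])

lemma proj_tensor_tensorial: "proj_tensor P \<in> tensorial_bodies D"
  using P proj_tensor_symmetric_body proj_tensor_subset_inj by (auto simp: tensorial_bodies_def)

end

section \<open>Hausdorff distance\<close>

lemma hausdist_le: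
  assumes "A \<noteq> {}" "B \<noteq> {}" "bounded A" "bounded B"
    "\<And>a. a \<in> A \<Longrightarrow> \<exists>b\<in>B. dist a b \<le> e" "\<And>b. b \<in> B \<Longrightarrow> \<exists>a\<in>A. dist b a \<le> e"
  shows "hausdist A B \<le> e"
proof -
  have "infdist a B \<le> e" if "a \<in> A" for a
    using assms(5)[OF that] infdist_le2 by blast
  moreover have "infdist b A \<le> e" if "b \<in> B" for b
    using assms(6)[OF that] infdist_le2 by blast
  ultimately have "(SUP a\<in>A. infdist a B) \<le> e" "(SUP b\<in>B. infdist b A) \<le> e"
    using assms(1,2) by (auto intro: cSUP_least)
  then show ?thesis
    using assms by (simp add: hausdist_def)
qed

lemma hausdist_nearest:
  fixes A B :: "'a::heine_borel set"
  assumes "bounded A" "compact B" "B \<noteq> {}" "a \<in> A"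
  obtains b where "b \<in> B" "dist a b \<le> hausdist A B"
proof -
  obtain b where "b \<in> B" "infdist a B = dist a b"
    using infdist_attains_inf[of B a] assms compact_imp_closed by metis
  then show thesis
    using that infdist_le_hausdist[of A B a] assms compact_imp_bounded by metis
qed

text \<open>Multiplicative closeness, chosen because it passes directly to intersections with a cone
  and to convex hulls.\<close>

definition sandwich :: "real \<Rightarrow> 'a::real_vector set \<Rightarrow> 'a set \<Rightarrow> bool" where
  "sandwich e A B \<longleftrightarrow> (*\<^sub>R) (1 - e) ` A \<subseteq> B \<and> B \<subseteq> (*\<^sub>R) (1 + e) ` A"

text \<open>If \<open>A\<close> lies in the Minkowski sum of \<open>B\<close> and the
  \<open>e\<close>-fold of \<open>A\<close>, the latter can be cancelled. Where a separating
  functional \<open>u\<close> attains its minimum over \<open>A\<close>, the decomposition makes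
  \<open>1 - e\<close> times that minimum at least \<open>u \<bullet> b\<close>, against the
  separation.\<close>

lemma Minkowski_cancel:
  fixes A B :: "'a::euclidean_space set"
  assumes "compact A" "closed B" "convex B" "0 \<le> e" "e < 1"
    and dec: "\<And>a. a \<in> A \<Longrightarrow> \<exists>b\<in>B. \<exists>a'\<in>A. a = b + e *\<^sub>R a'" and x: "x \<in> A"
  shows "(1 - e) *\<^sub>R x \<in> B"
proof (rule ccontr)
  assume "(1 - e) *\<^sub>R x \<notin> B"
  then obtain u c where u: "u \<bullet> ((1 - e) *\<^sub>R x) < c" "\<And>b. b \<in> B \<Longrightarrow> u \<bullet> b > c"
    using separating_hyperplane_closed_point[OF assms(3,2)] by blast
  obtain a where a: "a \<in> A" "\<And>a'. a' \<in> A \<Longrightarrow> u \<bullet> a \<le> u \<bullet> a'"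
    using continuous_attains_inf[OF assms(1), of "\<lambda>w. u \<bullet> w"] x
    by (force intro: continuous_intros)
  obtain b a' where b: "b \<in> B" "a' \<in> A" "a = b + e *\<^sub>R a'"
    using dec[OF a(1)] by blast
  show False
  proof -
    have "(1 - e) * (u \<bullet> a) \<le> (1 - e) * (u \<bullet> x)" "e * (u \<bullet> a) \<le> e * (u \<bullet> a')"
      using a(2)[OF x] a(2)[OF b(2)] assms(4,5) by (auto intro: mult_left_mono)
    moreover have "u \<bullet> a = u \<bullet> b + e * (u \<bullet> a')"
      using b(3) by (simp add: inner_add_right)
    ultimately show False
      using u(1) u(2)[OF b(1)] by (simp add: algebra_simps)
  qed
qed

text \<open>Vectors of \<open>V\<close> of length at most \<open>e * r\<close> lie in the
  \<open>e\<close>-fold of \<open>A\<close>. So each body lies in the other enlarged by the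
  \<open>e\<close>-fold of \<open>A\<close>; one inclusion follows by
  \<open>Minkowski_cancel\<close>, the other by convexity of \<open>A\<close>.\<close>

lemma hausdist_imp_sandwich:
  assumes "subspace V" "A \<in> symmetric_bodies V" "B \<in> symmetric_bodies V"
    "V \<inter> cball 0 r \<subseteq> A" "0 \<le> e" "e < 1" "hausdist A B \<le> e * r" "r > 0"
  shows "sandwich e A B"
proof -
  note A = symmetric_bodiesD[OF assms(2)] and B = symmetric_bodiesD[OF assms(3)]
  note nz = symmetric_bodies_0[OF assms(2,1)] symmetric_bodies_0[OF assms(3,1)]
  have small: "\<exists>a\<in>A. v = e *\<^sub>R a" if v: "v \<in> V" "norm v \<le> e * r" for v
  proof (cases "e = 0")
    case False
    then have "(1 / e) *\<^sub>R v \<in> A"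
      using v assms by (intro subsetD[OF assms(4)]) (auto simp: subspace_scale field_simps)
    then show ?thesis
      using False by (intro bexI[of _ "(1 / e) *\<^sub>R v"]) auto
  qed (use v nz in auto)
  have "(1 - e) *\<^sub>R a \<in> B" if "a \<in> A" for a
  proof (rule Minkowski_cancel[OF A(2) B(5,3) assms(5,6) _ that])
    fix a assume a: "a \<in> A"
    obtain b where b: "b \<in> B" "dist a b \<le> hausdist A B"
      using hausdist_nearest[OF A(4) B(2) _ a] nz by blast
    have "a - b \<in> V"
      using a b A(1) B(1) assms(1) by (auto intro: subspace_diff)
    then obtain a' where "a' \<in> A" "a - b = e *\<^sub>R a'"
      using small[of "a - b"] b assms(7) by (auto simp: dist_norm)
    then show "\<exists>b\<in>B. \<exists>a'\<in>A. a = b + e *\<^sub>R a'"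
      using b by (metis add.commute diff_add_cancel)
  qed
  moreover have "b \<in> (*\<^sub>R) (1 + e) ` A" if b: "b \<in> B" for b
  proof -
    obtain a where a: "a \<in> A" "dist b a \<le> hausdist A B"
      using hausdist_nearest[OF B(4) A(2) _ b] nz hausdist_commute[of B A] by auto
    have "b - a \<in> V"
      using a b A(1) B(1) assms(1) by (auto intro: subspace_diff)
    then obtain a' where a': "a' \<in> A" "b - a = e *\<^sub>R a'"
      using small[of "b - a"] a assms(7) by (auto simp: dist_norm)
    have "(1 / (1 + e)) *\<^sub>R a + (e / (1 + e)) *\<^sub>R a' \<in> A"
      using a a' assms(5) by (intro convexD[OF A(3)]) (auto simp: field_simps)
    moreover have "b = (1 + e) *\<^sub>R ((1 / (1 + e)) *\<^sub>R a + (e / (1 + e)) *\<^sub>R a')"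
    proof -
      have "1 + e \<noteq> 0" using assms(5) by simp
      then have "(1 + e) *\<^sub>R ((1 / (1 + e)) *\<^sub>R a + (e / (1 + e)) *\<^sub>R a') = a + e *\<^sub>R a'"
        by (simp add: scaleR_add_right)
      then show ?thesis
        using a'(2) by (simp add: algebra_simps)
    qed
    ultimately show ?thesis by blast
  qed
  ultimately show ?thesis
    by (auto simp: sandwich_def)
qed

text \<open>Scaling \<open>a\<close> by \<open>1 - e\<close> or \<open>1 + e\<close> moves it by
  \<open>e * norm a\<close>.\<close>

lemma sandwich_imp_hausdist:
  fixes A B :: "'a::real_normed_vector set"
  assumes "sandwich e A B" "A \<noteq> {}" "A \<subseteq> cball 0 M" "0 \<le> e"
  shows "hausdist A B \<le> e * M"
proof (rule hausdist_le)
  have near: "dist a ((1 - e) *\<^sub>R a) \<le> e * M" "dist ((1 + e) *\<^sub>R a) a \<le> e * M" if "a \<in> A" for a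
  proof -
    have "norm (e *\<^sub>R a) \<le> e * M"
      using assms(3,4) that by (auto intro!: mult_left_mono)
    then show "dist a ((1 - e) *\<^sub>R a) \<le> e * M" "dist ((1 + e) *\<^sub>R a) a \<le> e * M"
      by (simp_all add: dist_norm algebra_simps)
  qed
  show "B \<noteq> {}"
    using assms(1,2) by (auto simp: sandwich_def)
  show "bounded A"
    using assms(3) bounded_cball bounded_subset by blast
  then have "bounded ((*\<^sub>R) (1 + e) ` A)"
    by (rule bounded_scaling)
  then show "bounded B"
    using assms(1) bounded_subset unfolding sandwich_def by blast
  show "\<exists>b\<in>B. dist a b \<le> e * M" if "a \<in> A" for a
    using near(1)[OF that] assms(1) that unfolding sandwich_def by blast
  show "\<exists>a\<in>A. dist b a \<le> e * M" if "b \<in> B" for b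
    using near(2) assms(1) that unfolding sandwich_def by blast
qed (rule assms(2))

lemma decomposable_scale: "z \<in> decomposable D \<Longrightarrow> c *\<^sub>R z \<in> decomposable D"
proof -
  assume "z \<in> decomposable D"
  then obtain x where x: "z = tensor x" "\<forall>i. x i \<in> coord_space (D i)"
    by (auto simp: decomposable_def)
  obtain i :: 'a where True by blast
  have "c *\<^sub>R z = tensor (x(i := c *\<^sub>R x i))"
    by (simp add: tensor_upd_scale x)
  moreover have "\<forall>j. (x(i := c *\<^sub>R x i)) j \<in> coord_space (D j)"
    using x by (simp add: subspace_scale[OF subspace_coord_space])
  ultimately show ?thesis
    unfolding decomposable_def by blast
qed

text \<open>The decomposable tensors form a cone, so intersecting with them commutes with scaling,
  as does taking convex hulls.\<close>

lemma sandwich_conv_tensor: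
  assumes "sandwich e A B" "0 \<le> e" "e < 1"
  shows "sandwich e (conv_tensor D A) (conv_tensor D B)"
proof -
  have 1: "(*\<^sub>R) (1 - e) ` (A \<inter> decomposable D) \<subseteq> B \<inter> decomposable D"
    using assms(1) by (auto simp: sandwich_def intro: decomposable_scale)
  have 2: "B \<inter> decomposable D \<subseteq> (*\<^sub>R) (1 + e) ` (A \<inter> decomposable D)"
  proof
    fix b assume b: "b \<in> B \<inter> decomposable D"
    then obtain a where a: "a \<in> A" "b = (1 + e) *\<^sub>R a"
      using assms(1) by (auto simp: sandwich_def)
    have "a = (1 / (1 + e)) *\<^sub>R b"
      using a assms(2) by simp
    then have "a \<in> decomposable D"
      using b decomposable_scale by blast
    then show "b \<in> (*\<^sub>R) (1 + e) ` (A \<inter> decomposable D)"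
      using a by blast
  qed
  show ?thesis
    using hull_mono[OF 1, of convex] hull_mono[OF 2, of convex]
    by (simp add: sandwich_def conv_tensor_def convex_hull_scaling)
qed

text \<open>The distance functions of the sets are uniformly bounded and 1-Lipschitz, so by
  Arzela-Ascoli a subsequence converges uniformly on the ball to some \<open>g\<close>. The limit
  set is the zero set of \<open>g\<close>, and each \<open>g x\<close> is attained as the distance
  from \<open>x\<close> to one of its points.\<close>

lemma blaschke_selection:
  fixes X :: "nat \<Rightarrow> 'a::euclidean_space set"
  assumes X: "\<And>n. compact (X n)" "\<And>n. X n \<noteq> {}" "\<And>n. X n \<subseteq> cball 0 M"
  obtains k Q where "strict_mono (k :: nat \<Rightarrow> nat)" "compact Q" "Q \<noteq> {}"
    "(\<lambda>n. hausdist (X (k n)) Q) \<longlonglongrightarrow> 0"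
proof -
  let ?S = "cball (0::'a) M"
  define F where "F n x = infdist x (X n)" for n x
  have nearest: "\<exists>q\<in>X n. F n x = dist x q" for n x
    using infdist_attains_inf[of "X n" x] X compact_imp_closed unfolding F_def by metis
  have bound: "norm (F n x) \<le> 2 * M" if x: "x \<in> ?S" for n x
  proof -
    obtain q where "q \<in> X n" "F n x = dist x q" using nearest by blast
    then show ?thesis
      using X(3)[of n] x norm_triangle_ineq4[of x q] by (force simp: dist_norm)
  qed
  have Lipschitz: "\<bar>F n x - F n y\<bar> \<le> norm (x - y)" for n x y
    using infdist_triangle[of x "X n" y] infdist_triangle[of y "X n" x]
    by (auto simp: F_def dist_norm norm_minus_commute)
  obtain g k where g: "continuous_on ?S g" and k: "strict_mono (k :: nat \<Rightarrow> nat)"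
    and unif: "\<And>e. 0 < e \<Longrightarrow> \<exists>N. \<forall>n x. n \<ge> N \<and> x \<in> ?S \<longrightarrow> norm (F (k n) x - g x) < e"
  proof (rule Arzela_Ascoli[of ?S F "2 * M"])
    show "\<exists>d. 0 < d \<and> (\<forall>n y. y \<in> ?S \<and> norm (x - y) < d \<longrightarrow> norm (F n x - F n y) < e)"
      if "0 < e" for x e
      using that Lipschitz by (intro exI[of _ e]) (auto intro: le_less_trans)
  qed (use bound in auto)
  have lim: "(\<lambda>n. F (k n) x) \<longlonglongrightarrow> g x" if "x \<in> ?S" for x
    using unif that by (intro LIMSEQ_I) blast
  define Q where "Q = {x \<in> ?S. g x = 0}"
  have "closed Q"
    unfolding Q_def using g by (intro continuous_closed_preimage_constant) auto
  then have "compact Q"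
    unfolding Q_def by (metis (no_types, lifting) bounded_cball bounded_subset compact_eq_bounded_closed mem_Collect_eq subsetI)
  \<comment> \<open>A subsequence of the points nearest to \<open>x\<close> converges to some
    \<open>l\<close>. Then \<open>g l = 0\<close>, so \<open>l\<close> is in \<open>Q\<close>, and
    \<open>dist x l = g x\<close>.\<close>
  have near: "\<exists>q\<in>Q. dist x q = g x" if x: "x \<in> ?S" for x
  proof -
    have "\<exists>q. q \<in> X (k n) \<and> F (k n) x = dist x q" for n
      using nearest by blast
    then obtain q where q: "\<And>n. q n \<in> X (k n)" "\<And>n. F (k n) x = dist x (q n)"
      by metis
    have "\<forall>n. q n \<in> ?S" using q(1) X(3) by blast
    then obtain l j where l: "l \<in> ?S" and j: "strict_mono (j :: nat \<Rightarrow> nat)" "(q \<circ> j) \<longlonglongrightarrow> l"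
      using compact_cball[of "0::'a" M] unfolding compact_def by blast
    have kj: "(\<lambda>n. F (k (j n)) y) \<longlonglongrightarrow> g y" if "y \<in> ?S" for y
      using LIMSEQ_subseq_LIMSEQ[OF lim[OF that] j(1)] by (simp add: comp_def)
    have dist0: "(\<lambda>n. dist y (q (j n))) \<longlonglongrightarrow> dist y l" for y
      using j(2) by (intro tendsto_intros) (simp add: comp_def)
    have "F (k (j n)) l \<le> dist l (q (j n))" for n
      unfolding F_def using q(1) by (rule infdist_le)
    then have "g l \<le> dist l l"
      by (intro LIMSEQ_le[OF kj[OF l] dist0]) auto
    moreover have "0 \<le> g l"
      by (intro LIMSEQ_le_const[OF kj[OF l]]) (auto simp: F_def infdist_nonneg)
    ultimately have "l \<in> Q"
      using l by (simp add: Q_def)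
    moreover have "dist x l = g x"
      using LIMSEQ_unique[OF dist0 kj[OF x, unfolded q(2)]] .
    ultimately show ?thesis by blast
  qed
  obtain x where "x \<in> ?S" using X(2,3)[of 0] by blast
  then have "Q \<noteq> {}" using near by blast
  have "\<exists>N. \<forall>n\<ge>N. hausdist (X (k n)) Q \<le> e" if e: "0 < e" for e
  proof -
    obtain N where N: "\<And>n x. n \<ge> N \<Longrightarrow> x \<in> ?S \<Longrightarrow> \<bar>F (k n) x - g x\<bar> < e"
      using unif[OF e] by auto
    have "hausdist (X (k n)) Q \<le> e" if n: "n \<ge> N" for n
    proof (rule hausdist_le)
      fix a assume a: "a \<in> X (k n)"
      then have "F (k n) a = 0" "a \<in> ?S"
        using X(3)[of "k n"] by (auto simp: F_def)
      then show "\<exists>q\<in>Q. dist a q \<le> e"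
        using N[OF n, of a] near[of a] by force
    next
      fix q assume "q \<in> Q"
      then show "\<exists>a\<in>X (k n). dist q a \<le> e"
        using N[OF n, of q] nearest[of "k n" q] by (force simp: Q_def)
    qed (use X \<open>compact Q\<close> \<open>Q \<noteq> {}\<close> in \<open>auto simp: compact_imp_bounded\<close>)
    then show ?thesis by blast
  qed
  then have "(\<lambda>n. hausdist (X (k n)) Q) \<longlonglongrightarrow> 0"
    by (intro LIMSEQ_I) (metis (no_types, lifting) abs_of_nonneg diff_zero field_sum_of_halves
        hausdist_nonneg le_less_trans less_add_same_cancel1 half_gt_zero real_norm_def)
  then show thesis
    using that k \<open>compact Q\<close> \<open>Q \<noteq> {}\<close> by blast
qed

text \<open>Together with \<open>hausdist_limit_seq\<close> this describes the limit by sequences of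
  points, so that convexity, symmetry and closed bounds pass to it.\<close>

lemma hausdist_limit_mem:
  fixes Q :: "'a::heine_borel set"
  assumes "(\<lambda>n. hausdist (X n) Q) \<longlonglongrightarrow> 0" "\<And>n. compact (X n)" "compact Q" "Q \<noteq> {}"
    "\<And>n. z n \<in> X n" "z \<longlonglongrightarrow> l"
  shows "l \<in> Q"
proof -
  have "infdist l Q \<le> dist l (z n) + hausdist (X n) Q" for n
    using infdist_triangle[of l Q "z n"] infdist_le_hausdist[of "X n" Q "z n"] assms
    by (force simp: compact_imp_bounded)
  moreover have "(\<lambda>n. dist l (z n) + hausdist (X n) Q) \<longlonglongrightarrow> dist l l + 0"
    by (intro tendsto_intros assms)
  ultimately have "infdist l Q \<le> dist l l + 0"
    by (intro LIMSEQ_le_const) auto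
  then show ?thesis
    using assms(3,4) in_closed_iff_infdist_zero[of Q l] infdist_nonneg[of l Q]
    by (simp add: compact_imp_closed)
qed

lemma hausdist_limit_seq:
  fixes Q :: "'a::heine_borel set"
  assumes "(\<lambda>n. hausdist (X n) Q) \<longlonglongrightarrow> 0" "\<And>n. compact (X n)" "\<And>n. X n \<noteq> {}" "compact Q" "q \<in> Q"
  obtains z where "\<And>n. z n \<in> X n" "z \<longlonglongrightarrow> q"
proof -
  have "\<exists>z\<in>X n. dist q z \<le> hausdist (X n) Q" for n
    using hausdist_nearest[of Q "X n" q] assms compact_imp_bounded hausdist_commute by metis
  then obtain z where z: "\<And>n. z n \<in> X n" "\<And>n. dist (z n) q \<le> hausdist (X n) Q"
    by (metis dist_commute)
  have "(\<lambda>n. dist (z n) q) \<longlonglongrightarrow> 0"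
    by (rule real_tendsto_sandwich[OF _ _ tendsto_const assms(1)]) (use z in auto)
  then show thesis
    using that z tendsto_dist_iff by blast
qed

section \<open>The retraction and the homotopy\<close>

lemma tensorial_bodiesD:
  assumes "Q \<in> tensorial_bodies D"
  shows "Q \<in> symmetric_bodies (tensor_space D)" "compact Q" "bounded Q" "convex Q" "Q \<noteq> {}"
    "Q \<subseteq> tensor_space D" "0 \<in> Q"
proof -
  show Q: "Q \<in> symmetric_bodies (tensor_space D)"
    using assms by (simp add: tensorial_bodies_def)
  show "0 \<in> Q"
    by (rule symmetric_bodies_0[OF Q subspace_tensor_space])
  then show "Q \<noteq> {}" by blast
qed (use assms symmetric_bodiesD in \<open>auto simp: tensorial_bodies_def\<close>)

lemma tensorial_bodies_bound:
  assumes "Q \<in> tensorial_bodies D"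
  obtains M where "M > 0" "Q \<subseteq> cball 0 M"
proof -
  obtain M where "M > 0" "\<forall>x\<in>Q. norm x \<le> M"
    using tensorial_bodiesD(3)[OF assms] by (auto simp: bounded_pos)
  then show thesis by (intro that[of M]) auto
qed

lemma tensorial_bodiesE:
  assumes "Q \<in> tensorial_bodies D"
  obtains P where "\<And>i. P i \<in> symmetric_bodies (coord_space (D i))" "proj_tensor P \<subseteq> Q"
    "Q \<subseteq> inj_tensor D P" "conv_tensor D Q = proj_tensor P"
  using assms between_decomposable(2) unfolding tensorial_bodies_def by blast

lemma proj_bodies_tensorial: "proj_bodies D \<subseteq> tensorial_bodies D"
  using proj_tensor_tensorial by (auto simp: proj_bodies_def)

lemma conv_tensor_proj_bodies: "Q \<in> tensorial_bodies D \<Longrightarrow> conv_tensor D Q \<in> proj_bodies D"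
  by (elim tensorial_bodiesE) (auto simp: proj_bodies_def)

lemma conv_tensor_tensorial: "Q \<in> tensorial_bodies D \<Longrightarrow> conv_tensor D Q \<in> tensorial_bodies D"
  using conv_tensor_proj_bodies proj_bodies_tensorial by blast

lemma conv_tensor_subset: "Q \<in> tensorial_bodies D \<Longrightarrow> conv_tensor D Q \<subseteq> Q"
  by (elim tensorial_bodiesE) simp

text \<open>A projective body lies between itself and the injective body with the same
  factors.\<close>

lemma conv_tensor_fixed: "R \<in> proj_bodies D \<Longrightarrow> conv_tensor D R = R"
  using between_decomposable(2) proj_tensor_subset_inj unfolding proj_bodies_def by blast

text \<open>By \<open>GL_tensor_structure\<close>, \<open>T\<close> carries the generators of
  \<open>proj_tensor P\<close> to those of \<open>proj_tensor P'\<close>. For the outer bound,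
  testing \<open>T q\<close> against \<open>tensor y\<close> amounts to testing \<open>q\<close>
  against \<open>tensor w\<close>, where the \<open>w i\<close> are the factors of \<open>y\<close>
  pulled back by the adjoints of the \<open>t i\<close>; they lie in the polars of the
  \<open>P i\<close>.\<close>

lemma GL_tensor_image:
  assumes card: "\<And>i. card (D i) \<ge> 2" and T: "T \<in> GL_tensor D" and Q: "Q \<in> tensorial_bodies D"
  shows "T ` Q \<in> tensorial_bodies D" "conv_tensor D (T ` Q) = T ` conv_tensor D Q"
proof -
  obtain s t where s: "bij s" and t: "\<And>i. linear (t i)"
    and "\<And>i. inj_on (t i) (coord_space (D i))"
    and t_image: "\<And>i. t i ` coord_space (D i) = coord_space (D (s i))"
    and Tt: "\<And>x. (\<And>i. x i \<in> coord_space (D i)) \<Longrightarrow>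
      T (tensor x) = tensor (\<lambda>k. t (inv s k) (x (inv s k)))"
    using GL_tensor_structure[OF card T] by blast
  have inv_s: "s (inv s k) = k" "inv s (s i) = i" for k i
    using s by (simp_all add: bij_is_inj bij_is_surj surj_f_inv_f)
  have lin: "linear T" and TV: "T ` tensor_space D = tensor_space D"
    using T by (auto simp: GL_tensor_def bij_betw_def)
  obtain P where P: "\<And>i. P i \<in> symmetric_bodies (coord_space (D i))" "proj_tensor P \<subseteq> Q"
    "Q \<subseteq> inj_tensor D P" "conv_tensor D Q = proj_tensor P"
    using tensorial_bodiesE[OF Q] by blast
  define P' where "P' k = t (inv s k) ` P (inv s k)" for k
  have P': "P' k \<in> symmetric_bodies (coord_space (D k))" for k
    using symmetric_bodies_linear_image[OF P(1)[of "inv s k"] subspace_coord_space t[of "inv s k"]]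
    by (simp add: P'_def t_image inv_s)
  have sub: "x i \<in> P i \<Longrightarrow> x i \<in> coord_space (D i)" for x i
    using symmetric_bodiesD(1)[OF P(1)] by blast
  have "T ` tensor ` {x. \<forall>i. x i \<in> P i} = tensor ` {x. \<forall>k. x k \<in> P' k}"
  proof safe
    fix x assume x: "\<forall>i. x i \<in> P i"
    then have "T (tensor x) = tensor (\<lambda>k. t (inv s k) (x (inv s k)))"
      using sub by (intro Tt) blast
    then show "T (tensor x) \<in> tensor ` {x. \<forall>k. x k \<in> P' k}"
      using x by (auto simp: P'_def)
  next
    fix x assume "\<forall>k. x k \<in> P' k"
    then have "\<forall>k. \<exists>p. p \<in> P (inv s k) \<and> x k = t (inv s k) p"
      unfolding P'_def by blast
    then obtain p where p: "\<And>k. p k \<in> P (inv s k)" "\<And>k. x k = t (inv s k) (p k)"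
      by metis
    have ps: "p (s i) \<in> P i" for i
      using p(1)[of "s i"] by (simp add: inv_s)
    then have "T (tensor (\<lambda>i. p (s i))) = tensor (\<lambda>k. t (inv s k) (p (s (inv s k))))"
      using sub[of "\<lambda>i. p (s i)"] by (intro Tt) blast
    also have "\<dots> = tensor x"
      by (simp add: inv_s flip: p(2))
    finally show "tensor x \<in> T ` tensor ` {x. \<forall>i. x i \<in> P i}"
      using ps by (intro image_eqI[of _ _ "tensor (\<lambda>i. p (s i))"]) auto
  qed
  then have TP: "T ` proj_tensor P = proj_tensor P'"
    using convex_hull_linear_image[OF lin, of "tensor ` {x. \<forall>i. x i \<in> P i}"]
    by (simp add: proj_tensor_def)
  have "T q \<in> inj_tensor D P'" if q: "q \<in> Q" for q
    unfolding in_inj_tensor_iff[OF P']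
  proof (intro conjI allI impI)
    show "T q \<in> tensor_space D"
      using TV tensorial_bodiesD(6)[OF Q] q by blast
    fix y assume y: "\<forall>k. y k \<in> polar (coord_space (D k)) (P' k)"
    have "\<exists>w\<in>coord_space (D i). \<forall>x\<in>coord_space (D i). x \<bullet> w = t i x \<bullet> y (s i)" for i
      using adjoint_on_subspace[OF t subspace_coord_space] .
    then obtain w where w: "\<And>i. w i \<in> coord_space (D i)"
      "\<And>i x. x \<in> coord_space (D i) \<Longrightarrow> x \<bullet> w i = t i x \<bullet> y (s i)"
      by metis
    have wP: "w i \<in> polar (coord_space (D i)) (P i)" for i
    proof -
      have "x \<bullet> w i \<le> 1" if x: "x \<in> P i" for x
      proof -
        have "t i x \<in> P' (s i)"
          using x by (auto simp: P'_def inv_s)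
        then have "t i x \<bullet> y (s i) \<le> 1"
          using y unfolding polar_def by blast
        then show ?thesis
          using w(2)[OF sub[OF x]] by simp
      qed
      then show ?thesis
        using w(1) by (simp add: polar_def)
    qed
    \<comment> \<open>Points of \<open>Q\<close> need not be decomposable: the identity is checked
      on decomposable tensors and extends linearly to their span, the tensor space.\<close>
    have "tensor y \<bullet> T z = tensor w \<bullet> z" if "z \<in> span (decomposable D)" for z
      using that
    proof (induction rule: span_induct)
      case base
      show ?case
        by (intro subspaceI) (auto simp: linear_0 linear_add linear_scale lin inner_add_right)
    next
      case (step z)
      then obtain x where x: "z = tensor x" "\<And>i. x i \<in> coord_space (D i)"
        by (auto simp: decomposable_def)
      have "tensor y \<bullet> T z = (\<Prod>k\<in>UNIV. y k \<bullet> t (inv s k) (x (inv s k)))"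
        using Tt[OF x(2)] by (simp add: x(1) inner_tensor)
      also have "\<dots> = (\<Prod>i\<in>UNIV. y (s i) \<bullet> t i (x i))"
        using s by (intro prod.reindex_bij_witness[of _ s "inv s"]) (auto simp: inv_s)
      also have "\<dots> = tensor w \<bullet> z"
      proof -
        have "y (s i) \<bullet> t i (x i) = w i \<bullet> x i" for i
          using w(2)[OF x(2), of i] by (simp add: inner_commute)
        then show ?thesis
          by (simp add: x(1) inner_tensor)
      qed
      finally show ?case .
    qed
    then have "tensor y \<bullet> T q = tensor w \<bullet> q"
      using tensorial_bodiesD(6)[OF Q] q by (auto simp: span_decomposable)
    also have "\<dots> \<le> 1"
      using P(3) q wP unfolding in_inj_tensor_iff[OF P(1)] subset_iff by blast
    finally show "tensor y \<bullet> T q \<le> 1" .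
  qed
  then have inj: "T ` Q \<subseteq> inj_tensor D P'" by blast
  have proj: "proj_tensor P' \<subseteq> T ` Q"
    using P(2) TP by blast
  have "T ` Q \<in> symmetric_bodies (tensor_space D)"
    using symmetric_bodies_linear_image[OF tensorial_bodiesD(1)[OF Q] subspace_tensor_space lin]
    by (simp add: TV)
  then show "T ` Q \<in> tensorial_bodies D"
    using P' proj inj unfolding tensorial_bodies_def by blast
  show "conv_tensor D (T ` Q) = T ` conv_tensor D Q"
    using between_decomposable(2)[OF P' proj inj] TP P(4) by simp
qed

section \<open>Continuity of the retraction\<close>

lemma tensorial_sandwich:
  assumes A: "A \<in> tensorial_bodies D" and e: "0 < e" "e < 1"
  shows "\<exists>d>0. \<forall>B\<in>tensorial_bodies D. hausdist A B < d \<longrightarrow> sandwich e A B"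
proof -
  obtain r where r: "r > 0" "tensor_space D \<inter> cball 0 r \<subseteq> A"
    by (rule symmetric_bodies_ball[OF tensorial_bodiesD(1)[OF A] subspace_tensor_space])
  have "sandwich e A B" if "B \<in> tensorial_bodies D" "hausdist A B < e * r" for B
    using hausdist_imp_sandwich[OF subspace_tensor_space tensorial_bodiesD(1)[OF A]
        tensorial_bodiesD(1)[OF that(1)] r(2)] that(2) e r(1) by simp
  then show ?thesis
    using e r by (intro exI[of _ "e * r"]) auto
qed

text \<open>Closeness to \<open>A\<close> becomes a sandwich, passes through
  \<open>conv_tensor\<close>, and turns back into Hausdorff closeness because \<open>A\<close> is
  bounded.\<close>

lemma conv_tensor_continuous:
  assumes A: "A \<in> tensorial_bodies D" and e: "0 < e"
  shows "\<exists>d>0. \<forall>B\<in>tensorial_bodies D. hausdist A B < d \<longrightarrow>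
    hausdist (conv_tensor D A) (conv_tensor D B) < e"
proof -
  obtain M where M: "M > 0" "A \<subseteq> cball 0 M"
    by (rule tensorial_bodies_bound[OF A])
  \<comment> \<open>The first bound makes \<open>e' * M\<close> at most \<open>e / 2\<close>, the
    second keeps \<open>e'\<close> below 1.\<close>
  define e' where "e' = min (e / (2 * M)) (1 / 2)"
  have "e' * M \<le> e / (2 * M) * M"
    using M by (intro mult_right_mono) (auto simp: e'_def)
  then have e': "0 < e'" "e' < 1" "e' * M < e"
    using e M by (auto simp: e'_def)
  obtain d where d: "d > 0" "\<And>B. B \<in> tensorial_bodies D \<Longrightarrow> hausdist A B < d \<Longrightarrow> sandwich e' A B"
    using tensorial_sandwich[OF A e'(1,2)] by blast
  have "hausdist (conv_tensor D A) (conv_tensor D B) < e"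
    if "B \<in> tensorial_bodies D" "hausdist A B < d" for B
  proof -
    have "sandwich e' (conv_tensor D A) (conv_tensor D B)"
      using d(2)[OF that] e' by (intro sandwich_conv_tensor) auto
    moreover have "conv_tensor D A \<subseteq> cball 0 M"
      using conv_tensor_subset[OF A] M by blast
    ultimately have "hausdist (conv_tensor D A) (conv_tensor D B) \<le> e' * M"
      using tensorial_bodiesD(5)[OF conv_tensor_tensorial[OF A]] e'(1)
      by (intro sandwich_imp_hausdist) auto
    then show ?thesis using e' by simp
  qed
  then show ?thesis using d(1) by blast
qed

text \<open>The factors \<open>P'\<close> of \<open>Q\<close> are reached through polarity. Divided
  by \<open>1 + e\<close>, \<open>tensor y\<close> lies in the polar of
  \<open>proj_tensor P'\<close>; being decomposable, it is then a tensor of vectors from the polars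
  of the \<open>P' i\<close>, and such tensors bound \<open>Q\<close>.\<close>

lemma sandwich_factors_bound:
  assumes P: "\<And>i. P i \<in> symmetric_bodies (coord_space (D i))" and Q: "Q \<in> tensorial_bodies D"
    and sw: "sandwich e (proj_tensor P) (conv_tensor D Q)" and e: "0 \<le> e" and q: "q \<in> Q"
    and y: "\<And>i. y i \<in> polar (coord_space (D i)) (P i)"
  shows "tensor y \<bullet> q \<le> 1 + e"
proof -
  obtain P' where P': "\<And>i. P' i \<in> symmetric_bodies (coord_space (D i))"
    and "proj_tensor P' \<subseteq> Q" and Q_inj: "Q \<subseteq> inj_tensor D P'"
    and conv: "conv_tensor D Q = proj_tensor P'"
    using tensorial_bodiesE[OF Q] by blast
  have "proj_tensor (\<lambda>i. polar (coord_space (D i)) (P i)) \<subseteq> polar (tensor_space D) (proj_tensor P)"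
    using proj_tensor_subset_inj[OF polar_factors[OF P]] unfolding inj_tensor_polar_eq[OF P] .
  moreover have "tensor y \<in> proj_tensor (\<lambda>i. polar (coord_space (D i)) (P i))"
    unfolding proj_tensor_def by (rule hull_inc) (use y in blast)
  ultimately have ty: "tensor y \<in> polar (tensor_space D) (proj_tensor P)" by blast
  define u where "u = (1 / (1 + e)) *\<^sub>R tensor y"
  have "x \<bullet> u \<le> 1" if x: "x \<in> proj_tensor P'" for x
  proof -
    obtain r where "r \<in> proj_tensor P" "x = (1 + e) *\<^sub>R r"
      using sw x unfolding conv sandwich_def by blast
    then show ?thesis
      using ty e unfolding polar_def u_def by simp
  qed
  then have "u \<in> polar (tensor_space D) (proj_tensor P')"
    using ty by (simp add: polar_def u_def subspace_scale[OF subspace_tensor_space])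
  moreover have "tensor y \<in> decomposable D"
    using y by (auto simp: decomposable_def polar_def)
  then have "u \<in> decomposable D"
    unfolding u_def by (rule decomposable_scale)
  ultimately have "u \<in> tensor ` {x. \<forall>i. x i \<in> polar (coord_space (D i)) (P' i)}"
    using inj_tensor_decomposable[where D = D, OF polar_factors[where D = D and P = P', OF P']]
    unfolding inj_tensor_polar_eq[where D = D and P = P', OF P'] by blast
  then obtain y' where y': "u = tensor y'" "\<forall>i. y' i \<in> polar (coord_space (D i)) (P' i)"
    by blast
  have "u \<bullet> q \<le> 1"
    using Q_inj q y' unfolding in_inj_tensor_iff[OF P'] subset_iff by blast
  then show ?thesis
    using e by (simp add: u_def field_simps)
qed

text \<open>Convergence of the images alone bounds the \<open>Q n\<close> eventually, by
  \<open>sandwich_factors_bound\<close>, so Blaschke selection applies. The limit satisfies the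
  bounds with the factors \<open>P\<close> of \<open>R\<close> because the slack \<open>e\<close> is
  arbitrarily small.\<close>

lemma conv_tensor_proper:
  assumes Q: "\<And>n. Q n \<in> tensorial_bodies D" and R: "R \<in> proj_bodies D"
    and lim: "(\<lambda>n. hausdist (conv_tensor D (Q n)) R) \<longlonglongrightarrow> 0"
  obtains k Q' where "strict_mono (k :: nat \<Rightarrow> nat)" "Q' \<in> tensorial_bodies D"
    "conv_tensor D Q' = R" "(\<lambda>n. hausdist (Q (k n)) Q') \<longlonglongrightarrow> 0"
proof -
  obtain P where P: "\<And>i. P i \<in> symmetric_bodies (coord_space (D i))" "R = proj_tensor P"
    using R by (auto simp: proj_bodies_def)
  have RT: "R \<in> tensorial_bodies D"
    using R proj_bodies_tensorial by blast
  have sw: "\<exists>N. \<forall>n\<ge>N. sandwich e R (conv_tensor D (Q n))" if e: "0 < e" "e < 1" for e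
  proof -
    obtain d where d: "d > 0" "\<And>B. B \<in> tensorial_bodies D \<Longrightarrow> hausdist R B < d \<Longrightarrow> sandwich e R B"
      using tensorial_sandwich[OF RT e] by blast
    obtain N where "\<And>n. n \<ge> N \<Longrightarrow> norm (hausdist (conv_tensor D (Q n)) R - 0) < d"
      using LIMSEQ_D[OF lim d(1)] by blast
    then show ?thesis
      using d(2)[OF conv_tensor_tensorial[OF Q]]
      by (intro exI[of _ N]) (simp add: hausdist_commute[of R] hausdist_nonneg)
  qed
  have bound: "\<exists>N. \<forall>n\<ge>N. \<forall>q\<in>Q n. tensor y \<bullet> q \<le> 1 + e"
    if "0 < e" "e < 1" "\<And>i. y i \<in> polar (coord_space (D i)) (P i)" for e y
    using sw[OF that(1,2)] sandwich_factors_bound[OF P(1) Q _ less_imp_le[OF that(1)] _ that(3)]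
    unfolding P(2) by blast
  \<comment> \<open>A fixed slack of \<open>1 / 2\<close> suffices for boundedness and produces the
    factor \<open>3 / 2\<close> below.\<close>
  obtain N where N: "\<And>n. n \<ge> N \<Longrightarrow> sandwich (1 / 2) R (conv_tensor D (Q n))"
    using sw[of "1 / 2"] by auto
  have "inj_tensor D P \<in> symmetric_bodies (tensor_space D)"
    unfolding inj_tensor_def
    by (intro polar_symmetric_body proj_tensor_symmetric_body polar_factors P subspace_tensor_space)
  then obtain M where M: "\<And>q. q \<in> inj_tensor D P \<Longrightarrow> norm q \<le> M"
    using symmetric_bodiesD(4) unfolding bounded_iff by blast
  have norm_le: "norm q \<le> 3 / 2 * M" if n: "n \<ge> N" and q: "q \<in> Q n" for n q
  proof -
    have "tensor y \<bullet> q \<le> 1 + 1 / 2" if "\<And>i. y i \<in> polar (coord_space (D i)) (P i)" for y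
      using N[OF n] that q unfolding P(2) by (intro sandwich_factors_bound[OF P(1) Q]) auto
    then have "(2 / 3) *\<^sub>R q \<in> inj_tensor D P"
      using tensorial_bodiesD(6)[OF Q] q
      by (force simp: in_inj_tensor_iff[OF P(1)] subspace_scale[OF subspace_tensor_space])
    from M[OF this] show ?thesis by simp
  qed
  \<comment> \<open>The shift by \<open>N\<close> discards the finitely many bodies that the bound
    does not cover.\<close>
  then have "Q (n + N) \<subseteq> cball 0 (3 / 2 * M)" for n
    using norm_le[of "n + N"] by (intro subsetI) simp
  then obtain k Q' where k: "strict_mono (k :: nat \<Rightarrow> nat)" "compact Q'" "Q' \<noteq> {}"
    "(\<lambda>n. hausdist (Q (k n + N)) Q') \<longlonglongrightarrow> 0"
    using blaschke_selection[of "\<lambda>n. Q (n + N)" "3 / 2 * M"] tensorial_bodiesD(2,5)[OF Q] by metis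
  let ?k = "\<lambda>n. k n + N"
  have mono: "strict_mono ?k"
    using k(1) by (simp add: strict_mono_def)
  have large: "\<exists>m. \<forall>n\<ge>m. ?k n \<ge> N'" for N'
    using seq_suble[OF mono] by (meson le_trans)
  have mem: "l \<in> Q'" if "\<And>n. z n \<in> Q (?k n)" "z \<longlonglongrightarrow> l" for z l
    by (rule hausdist_limit_mem[OF k(4) tensorial_bodiesD(2)[OF Q] k(2,3) that])
  have approx: "\<exists>z. (\<forall>n. z n \<in> Q (?k n)) \<and> z \<longlonglongrightarrow> q" if "q \<in> Q'" for q
    by (rule hausdist_limit_seq[OF k(4) tensorial_bodiesD(2)[OF Q] tensorial_bodiesD(5)[OF Q] k(2) that])
      blast
  note Qb = symmetric_bodiesD[OF tensorial_bodiesD(1)[OF Q]]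
  have V: "Q' \<subseteq> tensor_space D"
  proof
    fix q assume "q \<in> Q'"
    then obtain z where z: "\<And>n. z n \<in> Q (?k n)" "z \<longlonglongrightarrow> q"
      using approx by blast
    have "\<And>n. z n \<in> tensor_space D"
      using z(1) Qb(1) by blast
    then show "q \<in> tensor_space D"
      using closed_sequentially[OF closed_subspace[OF subspace_tensor_space]] z(2) by metis
  qed
  have cv: "convex Q'"
  proof (rule convexI)
    fix p q and u v :: real
    assume pq: "p \<in> Q'" "q \<in> Q'" and uv: "0 \<le> u" "0 \<le> v" "u + v = 1"
    obtain z w where zw: "\<And>n. z n \<in> Q (?k n)" "z \<longlonglongrightarrow> p" "\<And>n. w n \<in> Q (?k n)" "w \<longlonglongrightarrow> q"
      using approx pq by metis
    show "u *\<^sub>R p + v *\<^sub>R q \<in> Q'"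
      by (rule mem[of "\<lambda>n. u *\<^sub>R z n + v *\<^sub>R w n"])
         (intro convexD[OF Qb(3)] tendsto_intros zw uv)+
  qed
  have sym: "- q \<in> Q'" if q: "q \<in> Q'" for q
  proof -
    obtain z where z: "\<And>n. z n \<in> Q (?k n)" "z \<longlonglongrightarrow> q"
      using approx q by blast
    show ?thesis
      by (rule mem[of "\<lambda>n. - z n"]) (rule Qb(6) z tendsto_minus)+
  qed
  have sub: "R \<subseteq> Q'"
  proof
    fix x assume x: "x \<in> R"
    note C = tensorial_bodiesD[OF conv_tensor_tensorial[OF Q]]
    have "(\<lambda>n. hausdist (conv_tensor D (Q (?k n))) R) \<longlonglongrightarrow> 0"
      using LIMSEQ_subseq_LIMSEQ[OF lim mono] by (simp add: comp_def)
    then obtain z where z: "\<And>n. z n \<in> conv_tensor D (Q (?k n))" "z \<longlonglongrightarrow> x"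
      by (rule hausdist_limit_seq[OF _ C(2) C(5) tensorial_bodiesD(2)[OF RT] x]) blast
    show "x \<in> Q'"
      by (rule mem[of z]) (use z subsetD[OF conv_tensor_subset[OF Q]] in \<open>simp_all\<close>)
  qed
  have inj: "Q' \<subseteq> inj_tensor D P"
  proof
    fix q assume q: "q \<in> Q'"
    then obtain z where z: "\<And>n. z n \<in> Q (?k n)" "z \<longlonglongrightarrow> q"
      using approx by blast
    have "tensor y \<bullet> q \<le> 1" if y: "\<And>i. y i \<in> polar (coord_space (D i)) (P i)" for y
    proof (rule field_le_epsilon)
      fix e :: real assume "0 < e"
      \<comment> \<open>The minimum meets the requirement of \<open>bound\<close> that the slack be
        below 1.\<close>
      then have e: "0 < min e (1 / 2)" "min e (1 / 2) < 1" by auto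
      obtain N' where "\<And>n. n \<ge> N' \<Longrightarrow> \<forall>q\<in>Q n. tensor y \<bullet> q \<le> 1 + min e (1 / 2)"
        using bound[OF e y] by blast
      then have "\<exists>m. \<forall>n\<ge>m. tensor y \<bullet> z n \<le> 1 + min e (1 / 2)"
        using large[of N'] z(1) by meson
      then have "tensor y \<bullet> q \<le> 1 + min e (1 / 2)"
        by (intro LIMSEQ_le_const2[OF tendsto_inner[OF tendsto_const z(2)]])
      then show "tensor y \<bullet> q \<le> 1 + e" by simp
    qed
    then show "q \<in> inj_tensor D P"
      using q V by (auto simp: in_inj_tensor_iff[OF P(1)])
  qed
  \<comment> \<open>A ball inside \<open>R\<close> remains inside \<open>Q'\<close>, which keeps the
    limit from degenerating.\<close>
  obtain r where r: "r > 0" "tensor_space D \<inter> cball 0 r \<subseteq> R"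
    by (rule symmetric_bodies_ball[OF tensorial_bodiesD(1)[OF RT] subspace_tensor_space])
  have "Q' \<in> symmetric_bodies (tensor_space D)"
    using r sub by (intro symmetric_bodiesI_ball[OF subspace_tensor_space V k(2) cv sym]) auto
  then have "Q' \<in> tensorial_bodies D"
    using P sub inj unfolding tensorial_bodies_def by blast
  moreover have "conv_tensor D Q' = R"
    using between_decomposable(2)[OF P(1) _ inj] sub P(2) by simp
  ultimately show thesis
    using that[OF mono _ _ k(4)] by blast
qed

section \<open>The homotopy\<close>

definition contraction ::
  "('l::finite \<Rightarrow> 'n::finite set) \<Rightarrow> (real ^ ('l \<Rightarrow> 'n)) set \<Rightarrow> real \<Rightarrow> (real ^ ('l \<Rightarrow> 'n)) set" where
  "contraction D Q t = (\<lambda>(x, y). (1 - t) *\<^sub>R x + t *\<^sub>R y) ` (Q \<times> conv_tensor D Q)"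

lemma contraction_0: "conv_tensor D Q \<noteq> {} \<Longrightarrow> contraction D Q 0 = Q"
  by (force simp: contraction_def)

lemma contraction_1: "Q \<noteq> {} \<Longrightarrow> contraction D Q 1 = conv_tensor D Q"
  by (force simp: contraction_def)

lemma contraction_subset:
  assumes Q: "Q \<in> tensorial_bodies D" and t: "t \<in> {0..1}"
  shows "contraction D Q t \<subseteq> Q"
proof
  fix z assume "z \<in> contraction D Q t"
  then obtain x y where "x \<in> Q" "y \<in> Q" "z = (1 - t) *\<^sub>R x + t *\<^sub>R y"
    using conv_tensor_subset[OF Q] by (auto simp: contraction_def)
  then show "z \<in> Q"
    using convexD[OF tensorial_bodiesD(4)[OF Q], of x y "1 - t" t] t by simp
qed

lemma conv_tensor_subset_contraction:
  assumes Q: "Q \<in> tensorial_bodies D"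
  shows "conv_tensor D Q \<subseteq> contraction D Q t"
proof
  fix y assume y: "y \<in> conv_tensor D Q"
  have "(1 - t) *\<^sub>R y + t *\<^sub>R y = y"
    by (simp flip: scaleR_add_left)
  then show "y \<in> contraction D Q t"
    using y conv_tensor_subset[OF Q] unfolding contraction_def
    by (intro image_eqI[of _ _ "(y, y)"]) auto
qed

text \<open>The set is a linear image of a product of compact convex sets. It lies between
  \<open>conv_tensor D Q\<close> and \<open>Q\<close>, so the factors that bound \<open>Q\<close>
  bound it too.\<close>

lemma contraction_tensorial:
  assumes Q: "Q \<in> tensorial_bodies D" and t: "t \<in> {0..1}"
  shows "contraction D Q t \<in> tensorial_bodies D"
proof -
  note R = conv_tensor_tensorial[OF Q]
  note C = tensorial_bodiesD[OF Q] tensorial_bodiesD[OF R]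
  obtain r where r: "r > 0" "tensor_space D \<inter> cball 0 r \<subseteq> conv_tensor D Q"
    by (rule symmetric_bodies_ball[OF tensorial_bodiesD(1)[OF R] subspace_tensor_space])
  have sub: "contraction D Q t \<subseteq> Q" "conv_tensor D Q \<subseteq> contraction D Q t"
    by (rule contraction_subset[OF Q t], rule conv_tensor_subset_contraction[OF Q])
  have "contraction D Q t \<in> symmetric_bodies (tensor_space D)"
  proof (rule symmetric_bodiesI_ball[OF subspace_tensor_space _ _ _ _ r(1)])
    show "contraction D Q t \<subseteq> tensor_space D" "tensor_space D \<inter> cball 0 r \<subseteq> contraction D Q t"
      using sub C(6) r(2) by blast+
    show "compact (contraction D Q t)"
      unfolding contraction_def case_prod_beta
      by (intro compact_continuous_image compact_Times C continuous_intros)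
    show "convex (contraction D Q t)"
      unfolding contraction_def case_prod_beta
      by (intro convex_linear_image convex_Times C linearI) (auto simp: algebra_simps)
    fix z assume "z \<in> contraction D Q t"
    then obtain x y where xy: "x \<in> Q" "y \<in> conv_tensor D Q" "z = (1 - t) *\<^sub>R x + t *\<^sub>R y"
      by (auto simp: contraction_def)
    have "- z = (1 - t) *\<^sub>R (- x) + t *\<^sub>R (- y)"
      using xy(3) by simp
    moreover have "- x \<in> Q" "- y \<in> conv_tensor D Q"
      using xy symmetric_bodiesD(6)[OF C(1)] symmetric_bodiesD(6)[OF tensorial_bodiesD(1)[OF R]]
      by blast+
    ultimately show "- z \<in> contraction D Q t"
      unfolding contraction_def by (intro image_eqI[of _ _ "(- x, - y)"]) auto
  qed
  moreover obtain P where "\<And>i. P i \<in> symmetric_bodies (coord_space (D i))" "proj_tensor P \<subseteq> Q"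
    "Q \<subseteq> inj_tensor D P" "conv_tensor D Q = proj_tensor P"
    using tensorial_bodiesE[OF Q] by blast
  ultimately show ?thesis
    using sub unfolding tensorial_bodies_def by blast
qed

text \<open>For a projective body the inner and the outer bound on the contraction coincide.\<close>

lemma contraction_fixed:
  assumes "R \<in> proj_bodies D" "t \<in> {0..1}"
  shows "contraction D R t = R"
proof -
  have "R \<in> tensorial_bodies D"
    using assms proj_bodies_tensorial by blast
  then show ?thesis
    using contraction_subset[OF _ assms(2)] conv_tensor_subset_contraction[of R D t]
      conv_tensor_fixed[OF assms(1)] by blast
qed

lemma contraction_linear_image:
  assumes "linear T" "conv_tensor D (T ` Q) = T ` conv_tensor D Q"
  shows "contraction D (T ` Q) t = T ` contraction D Q t"
proof -
  have "(1 - t) *\<^sub>R T x + t *\<^sub>R T y = T ((1 - t) *\<^sub>R x + t *\<^sub>R y)" for x y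
    by (simp add: linear_add linear_scale assms(1))
  moreover have "T ` Q \<times> T ` conv_tensor D Q = map_prod T T ` (Q \<times> conv_tensor D Q)"
    by auto
  ultimately show ?thesis
    unfolding contraction_def assms(2) by (simp add: image_image case_prod_beta)
qed

text \<open>A joint estimate in body and time, from which continuity on the product follows. Nearest
  points are chosen separately in the bodies and in their retracts.\<close>

lemma contraction_hausdist:
  assumes A: "A \<in> tensorial_bodies D" and B: "B \<in> tensorial_bodies D"
    and M: "A \<subseteq> cball 0 M" and t: "t \<in> {0..1}" and s: "s \<in> {0..1}"
  shows "hausdist (contraction D A t) (contraction D B s)
    \<le> hausdist A B + hausdist (conv_tensor D A) (conv_tensor D B) + 2 * M * \<bar>s - t\<bar>"
    (is "_ \<le> ?e")
proof (rule hausdist_le)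
  note Ab = tensorial_bodiesD[OF A] and Bb = tensorial_bodiesD[OF B]
  note Ac = tensorial_bodiesD[OF conv_tensor_tensorial[OF A]]
    and Bc = tensorial_bodiesD[OF conv_tensor_tensorial[OF B]]
  show "contraction D A t \<noteq> {}" "contraction D B s \<noteq> {}" "bounded (contraction D A t)"
    "bounded (contraction D B s)"
    using tensorial_bodiesD(3,5)[OF contraction_tensorial[OF A t]]
      tensorial_bodiesD(3,5)[OF contraction_tensorial[OF B s]] by auto
  have est: "dist ((1 - t) *\<^sub>R a + t *\<^sub>R a') ((1 - s) *\<^sub>R b + s *\<^sub>R b') \<le> ?e"
    if "a \<in> A" "a' \<in> conv_tensor D A" "dist a b \<le> hausdist A B"
      "dist a' b' \<le> hausdist (conv_tensor D A) (conv_tensor D B)" for a a' b b'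
  proof -
    \<comment> \<open>The last term collects the change of time; \<open>2 * M\<close> bounds the
      distance between two points of \<open>A\<close>.\<close>
    have "((1 - t) *\<^sub>R a + t *\<^sub>R a') - ((1 - s) *\<^sub>R b + s *\<^sub>R b')
        = (1 - s) *\<^sub>R (a - b) + s *\<^sub>R (a' - b') + (s - t) *\<^sub>R (a - a')"
      by (simp add: algebra_simps)
    also have "norm \<dots> \<le> norm ((1 - s) *\<^sub>R (a - b)) + norm (s *\<^sub>R (a' - b')) + norm ((s - t) *\<^sub>R (a - a'))"
      by (meson add_mono norm_triangle_le order_refl)
    also have "\<dots> \<le> hausdist A B + hausdist (conv_tensor D A) (conv_tensor D B) + 2 * M * \<bar>s - t\<bar>"
    proof (intro add_mono)
      show "norm ((1 - s) *\<^sub>R (a - b)) \<le> hausdist A B"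
        using s that(3) mult_mono[of "1 - s" 1 "norm (a - b)" "hausdist A B"] by (simp add: dist_norm)
      show "norm (s *\<^sub>R (a' - b')) \<le> hausdist (conv_tensor D A) (conv_tensor D B)"
        using s that(4) mult_mono[of s 1 "norm (a' - b')" "hausdist (conv_tensor D A) (conv_tensor D B)"]
        by (simp add: dist_norm)
      have "norm a \<le> M" "norm a' \<le> M"
        using that(1,2) M conv_tensor_subset[OF A] by auto
      then have "norm (a - a') \<le> 2 * M"
        using norm_triangle_ineq4[of a a'] by simp
      then show "norm ((s - t) *\<^sub>R (a - a')) \<le> 2 * M * \<bar>s - t\<bar>"
        by (simp add: mult.commute mult_left_mono)
    qed
    finally show ?thesis by (simp add: dist_norm)
  qed
  show "\<exists>w\<in>contraction D B s. dist z w \<le> ?e" if z: "z \<in> contraction D A t" for z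
  proof -
    obtain a a' where a: "a \<in> A" "a' \<in> conv_tensor D A" "z = (1 - t) *\<^sub>R a + t *\<^sub>R a'"
      using z by (auto simp: contraction_def)
    obtain b where "b \<in> B" "dist a b \<le> hausdist A B"
      using hausdist_nearest[OF Ab(3) Bb(2,5) a(1)] .
    moreover obtain b' where "b' \<in> conv_tensor D B"
      "dist a' b' \<le> hausdist (conv_tensor D A) (conv_tensor D B)"
      using hausdist_nearest[OF Ac(3) Bc(2,5) a(2)] .
    ultimately show ?thesis
      using est[OF a(1,2)] a(3)
      by (intro bexI[of _ "(1 - s) *\<^sub>R b + s *\<^sub>R b'"]) (auto simp: contraction_def)
  qed
  show "\<exists>z\<in>contraction D A t. dist w z \<le> ?e" if w: "w \<in> contraction D B s" for w
  proof -
    obtain b b' where b: "b \<in> B" "b' \<in> conv_tensor D B" "w = (1 - s) *\<^sub>R b + s *\<^sub>R b'"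
      using w by (auto simp: contraction_def)
    obtain a where a: "a \<in> A" "dist b a \<le> hausdist B A"
      using hausdist_nearest[OF Bb(3) Ab(2,5) b(1)] .
    obtain a' where a': "a' \<in> conv_tensor D A"
      "dist b' a' \<le> hausdist (conv_tensor D B) (conv_tensor D A)"
      using hausdist_nearest[OF Bc(3) Ac(2,5) b(2)] .
    have "dist ((1 - t) *\<^sub>R a + t *\<^sub>R a') w \<le> ?e"
      using est[OF a(1) a'(1), of b b'] a(2) a'(2) b(3)
      by (simp add: dist_commute hausdist_commute)
    then show ?thesis
      using a(1) a'(1)
      by (intro bexI[of _ "(1 - t) *\<^sub>R a + t *\<^sub>R a'"]) (auto simp: contraction_def dist_commute)
  qed
qed

section \<open>Continuity and properness in the metric topologies, and the conclusion\<close>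

lemma continuous_map_conv_tensor:
  "continuous_map (tensorial_topology D) (proj_topology D) (conv_tensor D)"
proof -
  interpret TB: Metric_space "tensorial_bodies D" hausdist
    by (rule Metric_space_tensorial_bodies)
  have "continuous_map TB.mtopology TB.mtopology (conv_tensor D)"
    unfolding TB.continuous_map_to_metric
  proof (intro ballI allI impI)
    fix A and e :: real assume A: "A \<in> topspace TB.mtopology" and e: "0 < e"
    then have A: "A \<in> tensorial_bodies D" by simp
    obtain d where d: "d > 0" "\<And>B. B \<in> tensorial_bodies D \<Longrightarrow> hausdist A B < d \<Longrightarrow>
        hausdist (conv_tensor D A) (conv_tensor D B) < e"
      using conv_tensor_continuous[OF A e] by blast
    show "\<exists>U. openin TB.mtopology U \<and> A \<in> U \<and> (\<forall>B\<in>U. conv_tensor D B \<in> TB.mball (conv_tensor D A) e)"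
      using A d conv_tensor_tensorial by (intro exI[of _ "TB.mball A d"]) auto
  qed
  then show ?thesis
    by (intro continuous_map_into_subtopology) (auto simp: conv_tensor_proj_bodies)
qed

text \<open>In metric spaces compactness is sequential. A sequence in the preimage is thinned by
  \<open>r\<close> so that its images converge in \<open>K\<close>, and then by \<open>k\<close> so
  that the bodies converge; the limit body retracts to the limit of the images.\<close>

lemma proper_continuous_conv_tensor:
  "proper_continuous (tensorial_topology D) (proj_topology D) (conv_tensor D)"
  unfolding proper_continuous_def
proof (intro conjI allI impI continuous_map_conv_tensor)
  interpret TB: Metric_space "tensorial_bodies D" hausdist
    by (rule Metric_space_tensorial_bodies)
  fix K assume "compactin (proj_topology D) K"
  then have K: "compactin TB.mtopology K" "K \<subseteq> proj_bodies D"
    by (auto simp: compactin_subtopology)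
  let ?L = "{x \<in> topspace TB.mtopology. conv_tensor D x \<in> K}"
  show "compactin TB.mtopology ?L"
    unfolding TB.compactin_sequentially
  proof (intro conjI allI impI)
    fix q :: "nat \<Rightarrow> _" assume q: "range q \<subseteq> ?L"
    then have "range (\<lambda>n. conv_tensor D (q n)) \<subseteq> K" by auto
    then obtain R r where R: "R \<in> K" and r: "strict_mono (r :: nat \<Rightarrow> nat)"
      and lim: "limitin TB.mtopology ((\<lambda>n. conv_tensor D (q n)) \<circ> r) R sequentially"
      using K(1) unfolding TB.compactin_sequentially by blast
    have qT: "q n \<in> tensorial_bodies D" for n using q by auto
    have "(\<lambda>n. hausdist (conv_tensor D (q (r n))) R) \<longlonglongrightarrow> 0"
      using lim by (simp add: TB.limitin_metric_dist_null)
    then obtain k Q where k: "strict_mono (k :: nat \<Rightarrow> nat)" and Q: "Q \<in> tensorial_bodies D"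
      "conv_tensor D Q = R" "(\<lambda>n. hausdist (q (r (k n))) Q) \<longlonglongrightarrow> 0"
      using conv_tensor_proper[of "\<lambda>n. q (r n)" D R] R K(2) qT by blast
    have "limitin TB.mtopology (q \<circ> (r \<circ> k)) Q sequentially"
      using Q qT by (simp add: TB.limitin_metric_dist_null)
    then show "\<exists>l r. l \<in> ?L \<and> strict_mono r \<and> limitin TB.mtopology (q \<circ> r) l sequentially"
      using Q R strict_mono_o[OF r k] by auto
  qed auto
qed

lemma continuous_map_contraction:
  "continuous_map (prod_topology (tensorial_topology D) (top_of_set {0..1}))
    (tensorial_topology D) (\<lambda>(Q, t). contraction D Q t)"
proof -
  interpret TB: Metric_space "tensorial_bodies D" hausdist
    by (rule Metric_space_tensorial_bodies)
  show ?thesis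
    unfolding TB.continuous_map_to_metric
  proof (intro ballI allI impI)
    fix At and e :: real
    assume At: "At \<in> topspace (prod_topology TB.mtopology (top_of_set {0..1::real}))" and e: "0 < e"
    then obtain A t where At_eq: "At = (A, t)" and A: "A \<in> tensorial_bodies D" and t: "t \<in> {0..1::real}"
      by auto
    obtain M where M: "M > 0" "A \<subseteq> cball 0 M"
      by (rule tensorial_bodies_bound[OF A])
    obtain d where d: "d > 0" "\<And>B. B \<in> tensorial_bodies D \<Longrightarrow> hausdist A B < d \<Longrightarrow>
        hausdist (conv_tensor D A) (conv_tensor D B) < e / 3"
      using conv_tensor_continuous[OF A, of "e / 3"] e by auto
    \<comment> \<open>The error \<open>e\<close> is split into thirds; the radius in time turns the
      coefficient \<open>2 * M\<close> into the last third.\<close>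
    define U where "U = TB.mball A (min d (e / 3)) \<times> ({0..1} \<inter> ball t (e / (6 * M)))"
    have "openin (prod_topology TB.mtopology (top_of_set {0..1::real})) U"
      unfolding U_def by (intro openin_prod_Times_iff[THEN iffD2] disjI2 conjI TB.openin_mball openin_open_Int open_ball)
    moreover have "At \<in> U"
      using A t d e M by (simp add: U_def At_eq)
    moreover have "contraction D B s \<in> TB.mball (contraction D A t) e" if "(B, s) \<in> U" for B s
    proof -
      have B: "B \<in> tensorial_bodies D" "hausdist A B < d" "hausdist A B < e / 3"
        and s: "s \<in> {0..1}" "\<bar>s - t\<bar> < e / (6 * M)"
        using that by (auto simp: U_def dist_real_def)
      have "2 * M * \<bar>s - t\<bar> < 2 * M * (e / (6 * M))"
        using s M by (intro mult_strict_left_mono) auto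
      also have "\<dots> = e / 3" using M by simp
      finally have "hausdist (contraction D A t) (contraction D B s) < e"
        using contraction_hausdist[OF A B(1) M(2) t s(1)] d(2)[OF B(1,2)] B(3) by linarith
      then show ?thesis
        using contraction_tensorial[OF A t] contraction_tensorial[OF B(1) s(1)] by simp
    qed
    ultimately show "\<exists>U. openin (prod_topology TB.mtopology (top_of_set {0..1::real})) U \<and> At \<in> U \<and>
        (\<forall>y\<in>U. (case y of (Q, t) \<Rightarrow> contraction D Q t) \<in> TB.mball (case At of (Q, t) \<Rightarrow> contraction D Q t) e)"
      unfolding At_eq by (intro exI[of _ U]) auto
  qed
qed

theorem proposition3p1:
  fixes D :: "'l::finite \<Rightarrow> 'n::finite set"
  assumes "\<And>i. card (D i) \<ge> 2"
  shows "(retraction_maps (tensorial_topology D) (proj_topology D) (conv_tensor D) id \<and>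
          equivariant_on (GL_tensor D) image (tensorial_bodies D) (conv_tensor D) \<and>
          proper_continuous (tensorial_topology D) (proj_topology D) (conv_tensor D)) \<and>
         strong_G_deformation_retract (GL_tensor D) image (tensorial_topology D) (proj_bodies D)"
proof -
  interpret TB: Metric_space "tensorial_bodies D" hausdist
    by (rule Metric_space_tensorial_bodies)
  have GL: "linear T" "T ` Q \<in> tensorial_bodies D" "conv_tensor D (T ` Q) = T ` conv_tensor D Q"
    if "T \<in> GL_tensor D" "Q \<in> tensorial_bodies D" for T Q
    using that GL_tensor_image[of D T Q, OF assms] by (auto simp: GL_tensor_def)
  have "retraction_maps (tensorial_topology D) (proj_topology D) (conv_tensor D) id"
    unfolding retraction_maps_def
    using continuous_map_conv_tensor conv_tensor_fixed
    by (auto intro: continuous_map_from_subtopology)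
  moreover have equi: "equivariant_on (GL_tensor D) image (tensorial_bodies D) (conv_tensor D)"
    using GL by (simp add: equivariant_on_def)
  moreover have "equivariant_on (GL_tensor D) image (tensorial_bodies D) (\<lambda>Q. contraction D Q t)" for t
    using GL by (simp add: equivariant_on_def contraction_linear_image)
  then have "strong_G_deformation_retract (GL_tensor D) image (tensorial_topology D) (proj_bodies D)"
    unfolding strong_G_deformation_retract_def TB.topspace_mtopology
  proof (intro conjI exI[of _ "conv_tensor D"] exI[of _ "contraction D"] ballI)
    \<comment> \<open>At each end one factor of the product has coefficient 0, and only its
      nonemptiness matters.\<close>
    show "contraction D Q 0 = Q" "contraction D Q 1 = conv_tensor D Q"
      if "Q \<in> tensorial_bodies D" for Q
      using tensorial_bodiesD(5)[OF that] tensorial_bodiesD(5)[OF conv_tensor_tensorial[OF that]]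
      by (simp_all add: contraction_0 contraction_1)
    show "contraction D Q t = Q" if "Q \<in> proj_bodies D" "t \<in> {0..1}" for Q t
      using that by (rule contraction_fixed)
  qed (use proj_bodies_tensorial continuous_map_conv_tensor continuous_map_contraction equi in auto)
  ultimately show ?thesis
    using proper_continuous_conv_tensor by blast
qed

end
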